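(* For integers $0\le m\le n$ with $n\ge1$, $d_{\rho_n,\rho_{n,m}}^{\rho_n}=2^{\binom{n}{2}-\binom{n-m}{2}}$.
   Context: $\rho_n=(n,n-1,\ldots,1)$ and $\rho_{n,m}=(n,n-1,\ldots,n-m+1)$, viewed as shifted diagrams (row $i$ indented $i-1$ units; boxes $(i,j)$ in matrix coordinates). $S_\mu$ is the superstandard tableau of shape $\mu$: boxes filled with $1,\ldots,|\mu|$ row by row in English reading order. Shifted edge labeled tableaux of shape $\nu/\lambda$ ($\lambda\subseteq\nu$ shifted shapes) with labels $[N]$: each box of $\nu/\lambda$ has one label; each diagonal edge (southern edge of a diagonal box $(i,i)$ of $\nu$) has a possibly empty set of labels; each label in $[N]$ appears exactly once; labels strictly increase along rows and down columns; each edge label exceeds any label directly north of it. The set is $\mathsf{SELT}(\nu/\lambda,N)$. In particular $\mathsf{SELT}(\rho_n/\rho_n,N)$ consists of distributions of $[N]$ into sets on the $n$ diagonal edges of $\rho_n$. $\mathsf{jdt}_{\mathsf c}(T)$ at an inner corner $\mathsf c$ (box of $\lambda$ with no box of $\lambda$ immediately east or south): place $\bullet$ in $\mathsf c$ and repeatedly: (1) with $a$ east, $b$ south, if $b<a$ (or no $a$) swap $\bullet,b$; (2) if $a<b$ (or no $b$) swap $\bullet,a$; (3) if $\bullet$ is in a diagonal box with $a$ east and edge set $S$ below, and $a<\min S$ or $S=\emptyset$, swap $\bullet,a$; (4) if $s=\min S<a$ (or no $a$), put $s$ into $\bullet$'s box, delete $s$ from $S$, stop. Also stop when nothing is directly south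 or east of $\bullet$; then delete $\bullet$ and its box. $\mathrm{Rect}(T)$: apply $\mathsf{jdt}$ at a southmost inner corner of the current shape, $|\lambda|$ times. $d_{\lambda,\mu}^{\nu}=\#\{T\in\mathsf{SELT}(\nu/\lambda,|\mu|):\mathrm{Rect}(T)=S_\mu\}$. *)

theory Defs
  imports Complex_Main
begin

text \<open>
  A shifted shape is given by its list of row lengths (a strict partition).  Boxes are in
  1-based matrix coordinates; row \<open>i\<close> is indented by \<open>i - 1\<close>, so it starts on the diagonal.
\<close>

definition diagram :: "nat list \<Rightarrow> (nat \<times> nat) set" where
  "diagram \<mu> = {(i, j). 1 \<le> i \<and> i \<le> length \<mu> \<and> i \<le> j \<and> j < i + \<mu> ! (i - 1)}"

definition rho :: "nat \<Rightarrow> nat list" where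
  "rho n = map (\<lambda>k. n - k) [0..<n]"

definition rho2 :: "nat \<Rightarrow> nat \<Rightarrow> nat list" where
  "rho2 n m = map (\<lambda>k. n - k) [0..<m]"

text \<open>
  A tableau is a pair \<open>(f, e)\<close>: \<open>f\<close> is the partial labeling of the boxes and \<open>e i\<close> is the set of
  labels on the southern edge of the diagonal box \<open>(i, i)\<close>.  The inner shape \<open>\<kappa>\<close> is carried
  separately; the outer shape is the inner shape together with \<open>dom f\<close>.  It is understood
  that \<open>diagram \<kappa> \<subseteq> diagram \<nu>\<close>.
\<close>

type_synonym tableau = "(nat \<times> nat \<rightharpoonup> nat) \<times> (nat \<Rightarrow> nat set)"

definition SELT :: "nat list \<Rightarrow> nat list \<Rightarrow> nat \<Rightarrow> tableau set" where
  "SELT \<nu> \<kappa> N = {(f, e).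
     dom f = diagram \<nu> - diagram \<kappa> \<and>
     (\<forall>i. e i \<noteq> {} \<longrightarrow> (i, i) \<in> diagram \<nu>) \<and>
     ran f \<union> (\<Union>i. e i) = {1..N} \<and>
     inj_on f (dom f) \<and>
     (\<forall>i. ran f \<inter> e i = {}) \<and>
     (\<forall>i j. i \<noteq> j \<longrightarrow> e i \<inter> e j = {}) \<and>
     (\<forall>i j j' a b. j < j' \<longrightarrow> f (i, j) = Some a \<longrightarrow> f (i, j') = Some b \<longrightarrow> a < b) \<and>
     (\<forall>i i' j a b. i < i' \<longrightarrow> f (i, j) = Some a \<longrightarrow> f (i', j) = Some b \<longrightarrow> a < b) \<and>
     (\<forall>i k a s. f (k, i) = Some a \<longrightarrow> s \<in> e i \<longrightarrow> a < s)}"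

definition superstandard :: "nat list \<Rightarrow> tableau" where
  "superstandard \<mu> =
     ((\<lambda>(i, j). if (i, j) \<in> diagram \<mu>
        then Some (sum_list (take (i - 1) \<mu>) + (j - i + 1)) else None),
      (\<lambda>_. {}))"

text \<open>
  \<open>slide i j T\<close> continues a slide whose bullet is in box \<open>(i, j)\<close>; the bullet's box carries no
  label, so deleting it when the bullet has nothing east or south leaves \<open>T\<close> unchanged.  At a
  diagonal box the edge set plays the role of the southern neighbour.  The bullet
  only moves east or south, so the recursion ends on every tableau with finitely many labels.
\<close>

partial_function (tailrec) slide :: "nat \<Rightarrow> nat \<Rightarrow> tableau \<Rightarrow> tableau" where
  "slide i j T = (case T of (f, e) \<Rightarrow>
     (if i = j then
        (case f (i, j + 1) of
           Some a \<Rightarrow>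
             (if e i = {} \<or> a < Min (e i)
              then slide i (j + 1) (f((i, j) \<mapsto> a, (i, j + 1) := None), e)
              else (f((i, j) \<mapsto> Min (e i)), e(i := e i - {Min (e i)})))
         | None \<Rightarrow>
             (if e i = {} then (f, e)
              else (f((i, j) \<mapsto> Min (e i)), e(i := e i - {Min (e i)}))))
      else
        (case f (i, j + 1) of
           Some a \<Rightarrow>
             (case f (i + 1, j) of
                Some b \<Rightarrow>
                  (if b < a
                   then slide (i + 1) j (f((i, j) \<mapsto> b, (i + 1, j) := None), e)
                   else slide i (j + 1) (f((i, j) \<mapsto> a, (i, j + 1) := None), e))
              | None \<Rightarrow> slide i (j + 1) (f((i, j) \<mapsto> a, (i, j + 1) := None), e))
         | None \<Rightarrow>
             (case f (i + 1, j) of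
                Some b \<Rightarrow> slide (i + 1) j (f((i, j) \<mapsto> b, (i + 1, j) := None), e)
              | None \<Rightarrow> (f, e)))))"

definition jdt :: "nat \<times> nat \<Rightarrow> tableau \<Rightarrow> tableau" where
  "jdt c T = slide (fst c) (snd c) T"

definition inner_corner :: "(nat \<times> nat) set \<Rightarrow> nat \<times> nat \<Rightarrow> bool" where
  "inner_corner D c \<longleftrightarrow>
     c \<in> D \<and> (fst c, snd c + 1) \<notin> D \<and> (fst c + 1, snd c) \<notin> D"

text \<open>A row of a shape contains at most one inner corner, so the southmost one is unique.\<close>

definition southmost_corner :: "(nat \<times> nat) set \<Rightarrow> nat \<times> nat" where
  "southmost_corner D =
     (THE c. inner_corner D c \<and> (\<forall>c'. inner_corner D c' \<longrightarrow> fst c' \<le> fst c))"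

definition rect_step :: "(nat \<times> nat) set \<times> tableau \<Rightarrow> (nat \<times> nat) set \<times> tableau" where
  "rect_step = (\<lambda>(D, T). (D - {southmost_corner D}, jdt (southmost_corner D) T))"

definition Rect :: "nat list \<Rightarrow> tableau \<Rightarrow> tableau" where
  "Rect \<kappa> T = snd ((rect_step ^^ sum_list \<kappa>) (diagram \<kappa>, T))"

definition d_coeff :: "nat list \<Rightarrow> nat list \<Rightarrow> nat list \<Rightarrow> nat" where
  "d_coeff \<kappa> \<mu> \<nu> = card {T \<in> SELT \<nu> \<kappa> (sum_list \<mu>). Rect \<kappa> T = superstandard \<mu>}"

end

theory Submission
  imports Defs
begin

text \<open>
  Call the labels of the first row of the superstandard tableau small; \<open>y c\<close> is the one in
  column \<open>c\<close>.  The rectification passes over the rows from bottom to top.  If the small labels rectify to the first row, then, by standardness and since each pass over a row can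
  add at most one small label to it, after the pass over row \<open>k\<close> the small labels in boxes are
  exactly \<open>a, y (k + 1), \<dots>, y n\<close> in row \<open>k\<close> for some \<open>a \<le> y k\<close>.  Going back from row \<open>k\<close> to row
  \<open>k + 1\<close> there are two possibilities: \<open>a\<close> came from edge \<open>k\<close>, or \<open>a\<close> was already in row \<open>k + 1\<close> and
  \<open>y (k + 1)\<close> came from edge \<open>k + 1\<close>.  So the small labels are placed according to a decomposition of
  the interval of columns into consecutive blocks: \<open>y c\<close> is on edge \<open>c\<close> unless \<open>c\<close> starts a block,
  and then it is on the edge of the last column of the block.  This gives \<open>2 ^ (n - 1)\<close> placements.
  Conversely, for such a placement the pass over row \<open>k\<close> lifts the row of small labels and acts on
  the remaining labels exactly as the pass over row \<open>k + 1\<close> would without the small ones.  Hence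
  the remaining labels may be placed on the edges \<open>2, \<dots>, n\<close> in any way that rectifies to the
  remaining rows, and induction on the number of rows gives the exponent
  \<open>(n - 1) + (n - 2) + \<dots> + (n - m)\<close>.
\<close>

section \<open>Slides\<close>

text \<open>The tail recursion of \<open>slide\<close> comes without an induction principle, so its
  graph is redefined inductively and the main properties follow by induction along the path of the
  bullet. The ties in \<open>edge\<close> and \<open>east\<close> follow the else branches of
  \<open>slide\<close>.\<close>

inductive slides :: "nat \<Rightarrow> nat \<Rightarrow> tableau \<Rightarrow> tableau \<Rightarrow> bool" where
  stop: "f (i, Suc j) = None \<Longrightarrow> (if i = j then e i = {} else f (Suc i, j) = None)
    \<Longrightarrow> slides i j (f, e) (f, e)"
| edge: "e i \<noteq> {} \<Longrightarrow> (\<And>a. f (i, Suc i) = Some a \<Longrightarrow> Min (e i) \<le> a)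
    \<Longrightarrow> slides i i (f, e) (f((i, i) \<mapsto> Min (e i)), e(i := e i - {Min (e i)}))"
| east: "f (i, Suc j) = Some a
    \<Longrightarrow> (if i = j then e i = {} \<or> a < Min (e i) else \<forall>b. f (Suc i, j) = Some b \<longrightarrow> a \<le> b)
    \<Longrightarrow> slides i (Suc j) (f((i, j) \<mapsto> a, (i, Suc j) := None), e) T
    \<Longrightarrow> slides i j (f, e) T"
| south: "i \<noteq> j \<Longrightarrow> f (Suc i, j) = Some b \<Longrightarrow> (\<forall>a. f (i, Suc j) = Some a \<longrightarrow> b < a)
    \<Longrightarrow> slides (Suc i) j (f((i, j) \<mapsto> b, (Suc i, j) := None), e) T
    \<Longrightarrow> slides i j (f, e) T"

lemma slides_slide: "slides i j T T' \<Longrightarrow> slide i j T = T'"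
proof (induction rule: slides.induct)
  case (stop f i j e)
  then show ?case by (subst slide.simps) (auto split: if_splits)
next
  case (edge e i f)
  then show ?case by (subst slide.simps) (force split: option.splits)
next
  case (east f i j a e T)
  then show ?case by (subst slide.simps) (auto split: option.splits if_splits)
next
  case (south i j f b e T)
  then show ?case by (subst slide.simps) (auto split: option.splits)
qed

definition bounded :: "nat \<Rightarrow> tableau \<Rightarrow> bool" where
  "bounded n T \<longleftrightarrow> dom (fst T) \<subseteq> {(i, j). i \<le> j \<and> j \<le> n}"

text \<open>A move is only made into an occupied box, which lies in the triangle. It brings one
  coordinate closer to \<open>n\<close>, so the truncated measure really drops.\<close>

lemma slides_exists:
  assumes "bounded n (f, e)" "i \<le> j"
  shows "\<exists>T. slides i j (f, e) T"
  using assms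
proof (induction "(n - i) + (n - j)" arbitrary: i j f rule: less_induct)
  case less
  have bd: "p \<le> q \<and> q \<le> n" if "f (p, q) = Some x" for p q x
    using less.prems that by (auto simp: bounded_def)
  have E: "\<exists>T. slides i (Suc j) (f((i, j) \<mapsto> a, (i, Suc j) := None), e) T"
    if "f (i, Suc j) = Some a" for a
    by (rule less.hyps) (use bd[OF that(1)] less.prems in \<open>auto simp: bounded_def\<close>)
  have S: "\<exists>T. slides (Suc i) j (f((i, j) \<mapsto> b, (Suc i, j) := None), e) T"
    if "f (Suc i, j) = Some b" for b
    by (rule less.hyps) (use bd[OF that(1)] less.prems in \<open>auto simp: bounded_def\<close>)
  show ?case
  proof (cases "i = j")
    case True
    show ?thesis
    proof (cases "f (i, Suc j)")
      case None
      then show ?thesis using True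
        by (cases "e i = {}") (metis stop, metis edge option.distinct(1))
    next
      case (Some a)
      then show ?thesis using True E[OF Some]
        by (cases "e i = {} \<or> a < Min (e i)") (metis east, metis edge not_less option.inject)
    qed
  next
    case False
    show ?thesis
    proof (cases "f (i, Suc j)")
      case None
      then show ?thesis using False S
        by (cases "f (Suc i, j)") (metis stop, metis south option.distinct(1))
    next
      case (Some a)
      then show ?thesis using False E[OF Some] S
        by (cases "\<exists>b. f (Suc i, j) = Some b \<and> b < a") (metis south option.inject, metis east not_less)
    qed
  qed
qed

lemma slides_total:
  assumes "bounded n T" "i \<le> j"
  shows "slides i j T (slide i j T)"
  using slides_exists[of n "fst T" "snd T" i j] assms slides_slide by (metis prod.collapse)

lemma slides_bounded: "slides i j T T' \<Longrightarrow> bounded n T \<Longrightarrow> i \<le> j \<Longrightarrow> j \<le> n \<Longrightarrow> bounded n T'"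
proof (induction rule: slides.induct)
  case (east f i j a e T)
  then have b: "i \<le> Suc j" "Suc j \<le> n" by (auto simp: bounded_def)
  then have "bounded n (f((i, j) \<mapsto> a, (i, Suc j) := None), e)"
    using east.prems by (auto simp: bounded_def)
  then show ?case using b by (intro east.IH)
next
  case (south i j f b e T)
  then have b: "Suc i \<le> j" "j \<le> n" by (auto simp: bounded_def)
  then have "bounded n (f((i, j) \<mapsto> b, (Suc i, j) := None), e)"
    using south.prems by (auto simp: bounded_def)
  then show ?case using b by (intro south.IH)
qed (auto simp: bounded_def)

text \<open>The bullet travels only east and south, so it changes boxes in its southeastern quadrant
  only and meets the diagonal no earlier than in its own column.\<close>

lemma slides_frame:
  "slides i j T T' \<Longrightarrow> (p < i \<or> q < j \<longrightarrow> fst T' (p, q) = fst T (p, q)) \<and> (p < j \<longrightarrow> snd T' p = snd T p)"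
  by (induction rule: slides.induct) auto

section \<open>Locality of slides\<close>

definition merge :: "(nat \<times> nat) set \<Rightarrow> tableau \<Rightarrow> tableau \<Rightarrow> tableau" where
  "merge R T U = ((\<lambda>p. if p \<in> R then fst T p else fst U p), (\<lambda>i. if (i, i) \<in> R then snd T i else snd U i))"

text \<open>Closure under the moves of a bullet. The southern condition stops at the diagonal, where
  the edge replaces the box below.\<close>

definition se_closed :: "(nat \<times> nat) set \<Rightarrow> bool" where
  "se_closed R \<longleftrightarrow> (\<forall>(i, j) \<in> R. (i, Suc j) \<in> R \<and> (i < j \<longrightarrow> (Suc i, j) \<in> R))"

text \<open>All comparisons and changes happen inside the closed region, so whatever stands outside
  may be exchanged. This allows one to compute with some rows or edges removed and to put them back
  afterwards.\<close>

lemma slides_merge: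
  "slides i j T T' \<Longrightarrow> se_closed R \<Longrightarrow> (i, j) \<in> R \<Longrightarrow> bounded n T \<Longrightarrow> i \<le> j \<Longrightarrow> j \<le> n
    \<Longrightarrow> slides i j (merge R T U) (merge R T' U)"
proof (induction rule: slides.induct)
  case (stop f i j e)
  then have "(i, Suc j) \<in> R" "i \<noteq> j \<Longrightarrow> (Suc i, j) \<in> R" by (auto simp: se_closed_def)
  with stop show ?case unfolding merge_def by (intro slides.stop) auto
next
  case (edge e i f)
  then have R: "(i, Suc i) \<in> R" "(i, i) \<in> R" by (auto simp: se_closed_def)
  let ?f = "\<lambda>p. if p \<in> R then f p else fst U p" and ?e = "\<lambda>i. if (i, i) \<in> R then e i else snd U i"
  have "slides i i (?f, ?e) (?f((i, i) \<mapsto> Min (?e i)), ?e(i := ?e i - {Min (?e i)}))"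
    using edge R by (intro slides.edge) auto
  also have "(?f((i, i) \<mapsto> Min (?e i)), ?e(i := ?e i - {Min (?e i)})) =
      merge R (f((i, i) \<mapsto> Min (e i)), e(i := e i - {Min (e i)})) U"
    using R by (auto simp: merge_def fun_eq_iff)
  finally show ?case unfolding merge_def fst_conv snd_conv .
next
  case (east f i j a e T)
  then have R: "(i, Suc j) \<in> R" "i \<noteq> j \<Longrightarrow> (Suc i, j) \<in> R" by (auto simp: se_closed_def)
  have b: "i \<le> Suc j" "Suc j \<le> n" using east.hyps east.prems by (auto simp: bounded_def)
  let ?f = "\<lambda>p. if p \<in> R then f p else fst U p" and ?e = "\<lambda>i. if (i, i) \<in> R then e i else snd U i"
  have "slides i (Suc j) (merge R (f((i, j) \<mapsto> a, (i, Suc j) := None), e) U) (merge R T U)"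
    using east b R by (intro east.IH) (auto simp: bounded_def)
  also have "merge R (f((i, j) \<mapsto> a, (i, Suc j) := None), e) U = (?f((i, j) \<mapsto> a, (i, Suc j) := None), ?e)"
    using R east.prems by (auto simp: merge_def fun_eq_iff)
  finally have sl: "slides i (Suc j) \<dots> (merge R T U)" .
  have "slides i j (?f, ?e) (merge R T U)"
  proof (rule slides.east[OF _ _ sl])
    show "?f (i, Suc j) = Some a" using R east.hyps(1) by simp
    show "if i = j then ?e i = {} \<or> a < Min (?e i) else \<forall>b. ?f (Suc i, j) = Some b \<longrightarrow> a \<le> b"
      using R east.hyps(2) east.prems(2) by (cases "i = j") auto
  qed
  then show ?case unfolding merge_def fst_conv snd_conv .
next
  case (south i j f b e T)
  then have R: "(i, Suc j) \<in> R" "i \<noteq> j \<Longrightarrow> (Suc i, j) \<in> R" by (auto simp: se_closed_def)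
  have b: "Suc i \<le> j" "j \<le> n" using south.hyps south.prems by (auto simp: bounded_def)
  let ?f = "\<lambda>p. if p \<in> R then f p else fst U p" and ?e = "\<lambda>i. if (i, i) \<in> R then e i else snd U i"
  have "slides (Suc i) j (merge R (f((i, j) \<mapsto> b, (Suc i, j) := None), e) U) (merge R T U)"
    using south b R by (intro south.IH) (auto simp: bounded_def)
  also have "merge R (f((i, j) \<mapsto> b, (Suc i, j) := None), e) U = (?f((i, j) \<mapsto> b, (Suc i, j) := None), ?e)"
    using R b south.prems by (auto simp: merge_def fun_eq_iff)
  finally have sl: "slides (Suc i) j \<dots> (merge R T U)" .
  have "slides i j (?f, ?e) (merge R T U)"
  proof (rule slides.south[OF south.hyps(1) _ _ sl])
    show "?f (Suc i, j) = Some b" using R south.hyps(1,2) by simp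
    show "\<forall>a. ?f (i, Suc j) = Some a \<longrightarrow> b < a"
      using R south.hyps(3) by simp
  qed
  then show ?case unfolding merge_def fst_conv snd_conv .
qed

lemma slide_merge:
  assumes "se_closed R" "(i, j) \<in> R" "bounded n T" "i \<le> j" "j \<le> n"
  shows "slide i j (merge R T U) = merge R (slide i j T) U"
  using assms slides_merge slides_slide slides_total by metis

section \<open>Conservation of labels\<close>

text \<open>Edges with index smaller than \<open>k\<close> are left out: only passes over rows above
  row \<open>k\<close> can draw on them.\<close>

definition labels :: "nat \<Rightarrow> tableau \<Rightarrow> nat set" where
  "labels k T = ran (fst T) \<union> (\<Union>i\<in>{k..}. snd T i)"

lemma in_labels: "x \<in> labels k (f, e) \<longleftrightarrow> (\<exists>p. f p = Some x) \<or> (\<exists>i\<ge>k. x \<in> e i)"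
  by (auto simp: labels_def ran_def)

lemma labels_move:
  assumes "f p = None" "f q = Some a"
  shows "labels k (f(p \<mapsto> a, q := None), e) = labels k (f, e)"
proof -
  have "p \<noteq> q" using assms by auto
  have "(\<exists>r. (f(p \<mapsto> a, q := None)) r = Some x) \<longleftrightarrow> (\<exists>r. f r = Some x)" for x
  proof
    assume "\<exists>r. (f(p \<mapsto> a, q := None)) r = Some x"
    then show "\<exists>r. f r = Some x" using assms(2) by (metis fun_upd_apply option.distinct(1))
  next
    assume "\<exists>r. f r = Some x"
    then obtain r where "f r = Some x" by blast
    then have "(f(p \<mapsto> a, q := None)) (if r = q then p else r) = Some x"
      using assms \<open>p \<noteq> q\<close> by auto
    then show "\<exists>r. (f(p \<mapsto> a, q := None)) r = Some x" by blast
  qed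
  then show ?thesis by (auto simp: in_labels)
qed

text \<open>No label is overwritten because the starting box is empty, and finiteness puts
  \<open>Min\<close> inside the edge set. As \<open>k \<le> j\<close>, an edge that gives up a label
  is counted by \<open>labels k\<close>.\<close>

lemma slides_labels:
  "slides i j T T' \<Longrightarrow> k \<le> j \<Longrightarrow> fst T (i, j) = None \<Longrightarrow> (\<And>i. finite (snd T i)) \<Longrightarrow> labels k T' = labels k T"
proof (induction rule: slides.induct)
  case (edge e i f)
  then have M: "Min (e i) \<in> e i" by auto
  have 1: "(\<exists>r. (f((i, i) \<mapsto> Min (e i))) r = Some x) \<longleftrightarrow> (\<exists>r. f r = Some x) \<or> x = Min (e i)" for x
  proof -
    have "(f((i, i) \<mapsto> Min (e i))) r = f r" if "f r = Some x" for r
      using edge.prems(2) that by auto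
    then show ?thesis by (metis fun_upd_apply option.inject)
  qed
  have 2: "(\<exists>j\<ge>k. x \<in> (e(i := e i - {Min (e i)})) j) \<or> x = Min (e i) \<longleftrightarrow> (\<exists>j\<ge>k. x \<in> e j)" for x
    using M edge.prems(1) by (auto split: if_splits)
  show ?case unfolding set_eq_iff in_labels using 1 2 by blast
next
  case (east f i j a e T)
  then have "labels k T = labels k (f((i, j) \<mapsto> a, (i, Suc j) := None), e)" by auto
  also have "\<dots> = labels k (f, e)" using east by (intro labels_move) auto
  finally show ?case .
next
  case (south i j f b e T)
  then have "labels k T = labels k (f((i, j) \<mapsto> b, (Suc i, j) := None), e)" by auto
  also have "\<dots> = labels k (f, e)" using south by (intro labels_move) auto
  finally show ?case .
qed auto


text \<open>
  Standardness relative to an inner shape \<open>D\<close>.  During a slide the box of the bullet counts as part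
  of \<open>D\<close>, and \<open>hole_ok\<close> says that its western and northern neighbours fit to the eastern and
  southern ones.
\<close>

definition tab :: "nat \<Rightarrow> (nat \<times> nat) set \<Rightarrow> tableau \<Rightarrow> bool" where
  "tab n D T \<longleftrightarrow>
     (\<forall>i j b. fst T (i, j) = Some b \<longrightarrow> i \<le> j \<and> j \<le> n \<and> (i, j) \<notin> D) \<and>
     (\<forall>i j b. fst T (i, Suc j) = Some b \<longrightarrow> i \<le> j \<longrightarrow> (i, j) \<notin> D \<longrightarrow> (\<exists>a<b. fst T (i, j) = Some a)) \<and>
     (\<forall>i j b. fst T (Suc i, j) = Some b \<longrightarrow> (i, j) \<notin> D \<longrightarrow> (\<exists>a<b. fst T (i, j) = Some a)) \<and>
     (\<forall>i s. s \<in> snd T i \<longrightarrow> i \<le> n \<and> ((i, i) \<notin> D \<longrightarrow> (\<exists>a<s. fst T (i, i) = Some a))) \<and>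
     (\<forall>i. finite (snd T i)) \<and>
     (\<forall>p q a. fst T p = Some a \<longrightarrow> fst T q = Some a \<longrightarrow> p = q) \<and>
     (\<forall>p i a. fst T p = Some a \<longrightarrow> a \<notin> snd T i) \<and>
     (\<forall>i j a. a \<in> snd T i \<longrightarrow> a \<in> snd T j \<longrightarrow> i = j)"

lemma tabD:
  assumes "tab n D (f, e)"
  shows "f (i, j) = Some b \<Longrightarrow> i \<le> j \<and> j \<le> n \<and> (i, j) \<notin> D"
    and "f (i, Suc j) = Some b \<Longrightarrow> i \<le> j \<Longrightarrow> (i, j) \<notin> D \<Longrightarrow> \<exists>a<b. f (i, j) = Some a"
    and "f (Suc i, j) = Some b \<Longrightarrow> (i, j) \<notin> D \<Longrightarrow> \<exists>a<b. f (i, j) = Some a"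
    and "s \<in> e i \<Longrightarrow> i \<le> n"
    and "s \<in> e i \<Longrightarrow> (i, i) \<notin> D \<Longrightarrow> \<exists>a<s. f (i, i) = Some a"
    and "finite (e i)"
    and "f p = Some a \<Longrightarrow> f q = Some a \<Longrightarrow> p = q"
    and "f p = Some a \<Longrightarrow> a \<notin> e i"
    and "a \<in> e i \<Longrightarrow> a \<in> e j \<Longrightarrow> i = j"
  using assms unfolding tab_def fst_conv snd_conv by meson+

lemma tabI:
  assumes "\<And>i j b. f (i, j) = Some b \<Longrightarrow> i \<le> j \<and> j \<le> n \<and> (i, j) \<notin> D"
    and "\<And>i j b. f (i, Suc j) = Some b \<Longrightarrow> i \<le> j \<Longrightarrow> (i, j) \<notin> D \<Longrightarrow> \<exists>a<b. f (i, j) = Some a"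
    and "\<And>i j b. f (Suc i, j) = Some b \<Longrightarrow> (i, j) \<notin> D \<Longrightarrow> \<exists>a<b. f (i, j) = Some a"
    and "\<And>i s. s \<in> e i \<Longrightarrow> i \<le> n"
    and "\<And>i s. s \<in> e i \<Longrightarrow> (i, i) \<notin> D \<Longrightarrow> \<exists>a<s. f (i, i) = Some a"
    and "\<And>i. finite (e i)"
    and "\<And>p q a. f p = Some a \<Longrightarrow> f q = Some a \<Longrightarrow> p = q"
    and "\<And>p i a. f p = Some a \<Longrightarrow> a \<notin> e i"
    and "\<And>i j a. a \<in> e i \<Longrightarrow> a \<in> e j \<Longrightarrow> i = j"
  shows "tab n D (f, e)"
  unfolding tab_def fst_conv snd_conv using assms by meson

lemma tab_move_distinct:
  assumes "tab n D (f, e)" "f q = Some x" "f p = None"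
  defines "g \<equiv> f(p \<mapsto> x, q := None)"
  shows "g r = Some a \<Longrightarrow> g r' = Some a \<Longrightarrow> r = r'" and "g r = Some a \<Longrightarrow> a \<notin> e i"
  using assms(2,3) tabD(7,8)[OF assms(1)] unfolding g_def
  by (metis fun_upd_apply option.distinct(1) option.inject)+

definition hole_ok :: "(nat \<times> nat) set \<Rightarrow> nat \<Rightarrow> nat \<Rightarrow> tableau \<Rightarrow> bool" where
  "hole_ok D i j T \<longleftrightarrow> (\<forall>p. (p = (i - 1, j) \<and> i \<noteq> 0 \<or> p = (i, j - 1) \<and> i < j) \<longrightarrow> p \<notin> D \<longrightarrow>
     (\<exists>a. fst T p = Some a \<and>
       (\<forall>b. fst T (i, Suc j) = Some b \<or> fst T (Suc i, j) = Some b \<or> i = j \<and> b \<in> snd T i \<longrightarrow> a < b)))"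

lemma hole_okD:
  assumes "hole_ok D i j T"
    and "fst T (i, Suc j) = Some x \<or> fst T (Suc i, j) = Some x \<or> i = j \<and> x \<in> snd T i"
  shows "i = Suc i' \<Longrightarrow> (i', j) \<notin> D \<Longrightarrow> \<exists>a<x. fst T (i', j) = Some a"
    and "j = Suc j' \<Longrightarrow> i \<le> j' \<Longrightarrow> (i, j') \<notin> D \<Longrightarrow> \<exists>a<x. fst T (i, j') = Some a"
proof -
  assume "i = Suc i'" "(i', j) \<notin> D"
  then show "\<exists>a<x. fst T (i', j) = Some a"
    using assms(1)[unfolded hole_ok_def, rule_format, of "(i', j)"] assms(2) by auto
next
  assume "j = Suc j'" "i \<le> j'" "(i, j') \<notin> D"
  then show "\<exists>a<x. fst T (i, j') = Some a"
    using assms(1)[unfolded hole_ok_def, rule_format, of "(i, j')"] assms(2) by auto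
qed

text \<open>The smaller of the two neighbours fills the hole, so it fits to the other one, and by
  \<open>hole_ok\<close> it fits to the northern and western neighbours. The same condition then
  holds at the next hole.\<close>

lemma slides_tab:
  "slides i j T T' \<Longrightarrow> tab n (insert (i, j) D) T \<Longrightarrow> (i, j) \<notin> D \<Longrightarrow> i \<le> j \<Longrightarrow> j \<le> n
    \<Longrightarrow> hole_ok D i j T
    \<Longrightarrow> tab n D T'"
proof (induction rule: slides.induct)
  case (stop f i j e)
  note t = tabD[OF stop.prems(1)]
  have S: "f (Suc i, j) = None"
    using t(1)[of "Suc i" j] stop.hyps(2) stop.prems by (cases "f (Suc i, j)") (auto split: if_splits)
  show ?case
    apply (rule tabI)
    subgoal using t(1) by blast
    subgoal for i' j' b using t(2)[of i' j' b] stop.hyps by (cases "i' = i \<and> j' = j") auto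
    subgoal for i' j' b using t(3)[of i' j' b] S by (cases "i' = i \<and> j' = j") auto
    subgoal using t(4) by blast
    subgoal for i' s using t(5)[of s i'] stop.hyps by (auto split: if_splits)
    subgoal using t(6) by blast
    subgoal using t(7) by blast
    subgoal using t(8) by blast
    subgoal using t(9) by blast
    done
next
  case (edge e i f)
  note t = tabD[OF edge.prems(1)]
  let ?s = "Min (e i)"
  have s: "?s \<in> e i" using t(6) edge.hyps by auto
  have ss: "?s < x" if "x \<in> e i" "x \<noteq> ?s" for x
    using that t(6)[of i] by (metis Min_le le_neq_implies_less)
  \<comment> \<open>Distinctness of labels turns the weak inequality of the slide rule into a strict
    one.\<close>
  have E: "?s < a" if "f (i, Suc i) = Some a" for a
    using edge.hyps(2)[OF that] t(8)[OF that, of i] s by (metis le_neq_implies_less)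
  have h: "f (i, i) = None" using t(1)[of i i] by (cases "f (i, i)") auto
  have S: "f (Suc i, i) = None" using t(1)[of "Suc i" i] by (cases "f (Suc i, i)") auto
  have ns: "f p \<noteq> Some ?s" for p using t(8)[of p ?s i] s by auto
  have N: "\<exists>x<?s. f (i', i) = Some x" if "i = Suc i'" "(i', i) \<notin> D" for i'
    using hole_okD(1)[OF edge.prems(5) _ that, of ?s] s by simp
  show ?case
    apply (rule tabI)
    subgoal for i' j' b using t(1)[of i' j' b] edge.prems by (auto split: if_splits)
    subgoal for i' j' b using t(2)[of i' j' b] E h by (cases "i' = i \<and> j' = i") (auto split: if_splits)
    subgoal premises p for i' j' b
    proof (cases "(Suc i', j') = (i, i)")
      case True
      then show ?thesis using p N[of i'] by auto
    next
      case False
      then have f: "f (Suc i', j') = Some b" using p(1) by (metis fun_upd_other)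
      then have ne: "(i', j') \<noteq> (i, i)" using S by (metis option.distinct(1) prod.inject)
      then have "\<exists>a<b. f (i', j') = Some a" using t(3)[OF f] p(2) by blast
      then show ?thesis using ne by (metis fun_upd_other)
    qed
    subgoal for i' s using t(4)[of s i'] by (auto split: if_splits)
    subgoal for i' s using t(5)[of s i'] ss by (auto split: if_splits)
    subgoal using t(6) by auto
    subgoal for p q a using t(7)[of p a q] ns by (auto split: if_splits)
    subgoal for p i' a using t(8)[of p a i'] t(9)[OF s, of i'] by (cases "p = (i, i)"; cases "i' = i") auto
    subgoal for i' j' a using t(9)[of a i' j'] by (auto split: if_splits)
    done
next
  case (east f i j a e T)
  note t = tabD[OF east.prems(1)]
  let ?g = "f((i, j) \<mapsto> a, (i, Suc j) := None)"
  have jn: "i \<le> Suc j" "Suc j \<le> n" "(i, Suc j) \<notin> D" using t(1)[OF east.hyps(1)] by auto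
  have h: "f (i, j) = None" using t(1)[of i j] by (cases "f (i, j)") auto
  have S: "a < b" if "f (Suc i, j) = Some b" for b
    using east.hyps(1,2) that t(1)[OF that] t(7)[of "(i, Suc j)" a "(Suc i, j)"]
    by (auto split: if_splits simp: order_less_le)
  have S': "a < b" if "b \<in> e i" "i = j" for b
    using that east.hyps(2) t(6)[of i] by (auto dest: Min_le[rotated])
  have N: "\<exists>x<a. f (i', j) = Some x" if "i = Suc i'" "(i', j) \<notin> D" for i'
    using hole_okD(1)[OF east.prems(5) _ that, of a] east.hyps(1) by simp
  have W: "\<exists>x<a. f (i, j') = Some x" if "j = Suc j'" "i \<le> j'" "(i, j') \<notin> D" for j'
    using hole_okD(2)[OF east.prems(5) _ that, of a] east.hyps(1) by simp
  note mv = tab_move_distinct[OF east.prems(1) east.hyps(1) h]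
  have "tab n (insert (i, Suc j) D) (?g, e)"
    apply (rule tabI)
    subgoal for i' j' b using t(1)[of i' j' b] east.prems by (auto split: if_splits)
    subgoal premises p for i' j' x
    proof (cases "(i', Suc j') = (i, j)")
      case True
      then have "x = a" "j = Suc j'" "i' = i" using p(1) by auto
      then show ?thesis using W[of j'] p by auto
    next
      case False
      then have ne: "(i', Suc j') \<noteq> (i, Suc j)" and f: "f (i', Suc j') = Some x"
        using p(1) by (metis fun_upd_apply option.distinct(1))+
      show ?thesis
      proof (cases "(i', j') = (i, j)")
        case True
        then show ?thesis using f ne  by auto
      next
        case ij: False
        then have "\<exists>a<x. f (i', j') = Some a" using t(2)[OF f] p by blast
        then show ?thesis using ij p by (metis fun_upd_apply insertCI)
      qed
    qed
    subgoal premises p for i' j' x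
    proof (cases "(Suc i', j') = (i, j)")
      case True
      then have "x = a" "i = Suc i'" "j' = j" using p(1) by auto
      then show ?thesis using N[of i'] p by auto
    next
      case False
      then have ne: "(Suc i', j') \<noteq> (i, Suc j)" and f: "f (Suc i', j') = Some x"
        using p(1) by (metis fun_upd_apply option.distinct(1))+
      show ?thesis
      proof (cases "(i', j') = (i, j)")
        case True
        then show ?thesis using f ne S by auto
      next
        case ij: False
        then have "\<exists>a<x. f (i', j') = Some a" using t(3)[OF f] p by blast
        then show ?thesis using ij p by (metis fun_upd_apply insertCI)
      qed
    qed
    subgoal for i' s using t(4)[of s i'] by (auto split: if_splits)
    subgoal for i' s using t(5)[of s i'] S' by (auto split: if_splits)
    subgoal using t(6) by auto
    subgoal for p q x using mv(1)[of p x q] by simp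
    subgoal for p i' x using mv(2)[of p x i'] by simp
    subgoal for i' j' x using t(9)[of x i' j'] by simp
    done
  moreover have "hole_ok D i (Suc j) (?g, e)"
    unfolding hole_ok_def fst_conv snd_conv
  proof (intro allI impI)
    fix p
    assume p: "p = (i - 1, Suc j) \<and> i \<noteq> 0 \<or> p = (i, Suc j - 1) \<and> i < Suc j" "p \<notin> D"
    \<comment> \<open>Whatever borders the new hole on the east or south stood east or south of
      \<open>a\<close> before the move.\<close>
    have B: "a < b" if "?g (i, Suc (Suc j)) = Some b \<or> ?g (Suc i, Suc j) = Some b \<or> i = Suc j \<and> b \<in> e i" for b
    proof -
      have "f (i, Suc (Suc j)) = Some b \<or> f (Suc i, Suc j) = Some b"
        using that east.prems(3) by (auto split: if_splits)
      then show ?thesis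
        using t(2)[of i "Suc j" b] t(3)[of i "Suc j" b] jn east.hyps(1) by auto
    qed
    have "\<exists>x\<le>a. ?g p = Some x"
    proof (cases "p = (i, j)")
      case False
      then obtain i' where "p = (i', Suc j)" "i = Suc i'" using p by (cases i) auto
      then show ?thesis using t(3)[of i' "Suc j" a] p east.hyps(1) by (auto intro: less_imp_le)
    qed simp
    then show "\<exists>x. ?g p = Some x \<and> (\<forall>b. ?g (i, Suc (Suc j)) = Some b \<or> ?g (Suc i, Suc j) = Some b
        \<or> i = Suc j \<and> b \<in> e i \<longrightarrow> x < b)"
      using B by (meson le_less_trans)
  qed
  ultimately show ?case using jn by (intro east.IH) auto
next
  case (south i j f b e T)
  note t = tabD[OF south.prems(1)]
  let ?g = "f((i, j) \<mapsto> b, (Suc i, j) := None)"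
  have jn: "Suc i \<le> j" "(Suc i, j) \<notin> D" using t(1)[OF south.hyps(2)] by auto
  have h: "f (i, j) = None" using t(1)[of i j] by (cases "f (i, j)") auto
  have E: "b < a" if "f (i, Suc j) = Some a" for a
    using south.hyps(3) that by auto
  have N: "\<exists>x<b. f (i', j) = Some x" if "i = Suc i'" "(i', j) \<notin> D" for i'
    using hole_okD(1)[OF south.prems(5) _ that, of b] south.hyps(2) by simp
  have W: "\<exists>x<b. f (i, j') = Some x" if "j = Suc j'" "i \<le> j'" "(i, j') \<notin> D" for j'
    using hole_okD(2)[OF south.prems(5) _ that, of b] south.hyps(2) by simp
  note mv = tab_move_distinct[OF south.prems(1) south.hyps(2) h]
  have "tab n (insert (Suc i, j) D) (?g, e)"
    apply (rule tabI)
    subgoal for i' j' x using t(1)[of i' j' x] south.prems by (auto split: if_splits)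
    subgoal premises p for i' j' x
    proof (cases "(i', Suc j') = (i, j)")
      case True
      then have "x = b" "j = Suc j'" "i' = i" using p(1) by auto
      then show ?thesis using W[of j'] p by auto
    next
      case False
      then have ne: "(i', Suc j') \<noteq> (Suc i, j)" and f: "f (i', Suc j') = Some x"
        using p(1) by (metis fun_upd_apply option.distinct(1))+
      show ?thesis
      proof (cases "(i', j') = (i, j)")
        case True
        then show ?thesis using f ne E by auto
      next
        case ij: False
        then have "\<exists>a<x. f (i', j') = Some a" using t(2)[OF f] p by blast
        then show ?thesis using ij p by (metis fun_upd_apply insertCI)
      qed
    qed
    subgoal premises p for i' j' x
    proof (cases "(Suc i', j') = (i, j)")
      case True
      then have "x = b" "i = Suc i'" "j' = j" using p(1) by auto
      then show ?thesis using N[of i'] p by auto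
    next
      case False
      then have ne: "(Suc i', j') \<noteq> (Suc i, j)" and f: "f (Suc i', j') = Some x"
        using p(1) by (metis fun_upd_apply option.distinct(1))+
      show ?thesis
      proof (cases "(i', j') = (i, j)")
        case True
        then show ?thesis using f ne  by auto
      next
        case ij: False
        then have "\<exists>a<x. f (i', j') = Some a" using t(3)[OF f] p by blast
        then show ?thesis using ij p by (metis fun_upd_apply insertCI)
      qed
    qed
    subgoal for i' s using t(4)[of s i'] by (auto split: if_splits)
    subgoal for i' s using t(5)[of s i'] south.hyps(1) by (auto split: if_splits)
    subgoal using t(6) by auto
    subgoal for p q x using mv(1)[of p x q] by simp
    subgoal for p i' x using mv(2)[of p x i'] by simp
    subgoal for i' j' x using t(9)[of x i' j'] by simp
    done
  moreover have "hole_ok D (Suc i) j (?g, e)"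
    unfolding hole_ok_def fst_conv snd_conv
  proof (intro allI impI)
    fix p
    assume p: "p = (Suc i - 1, j) \<and> Suc i \<noteq> 0 \<or> p = (Suc i, j - 1) \<and> Suc i < j" "p \<notin> D"
    have B: "b < y" if "?g (Suc i, Suc j) = Some y \<or> ?g (Suc (Suc i), j) = Some y \<or> Suc i = j \<and> y \<in> e (Suc i)" for y
    proof -
      have "f (Suc i, Suc j) = Some y \<or> f (Suc (Suc i), j) = Some y \<or> Suc i = j \<and> y \<in> e (Suc i)"
        using that by (auto split: if_splits)
      then show ?thesis
        using t(2)[of "Suc i" j y] t(3)[of "Suc i" j y] t(5)[of y "Suc i"] jn south.hyps(2) by auto
    qed
    have "\<exists>x\<le>b. ?g p = Some x"
    proof (cases "p = (i, j)")
      case False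
      then obtain j' where "p = (Suc i, j')" "j = Suc j'" "Suc i \<le> j'" using p by (cases j) auto
      then show ?thesis using t(2)[of "Suc i" j' b] p south.hyps(2) by (auto intro: less_imp_le)
    qed (use jn in simp)
    then show "\<exists>x. ?g p = Some x \<and> (\<forall>y. ?g (Suc i, Suc j) = Some y \<or> ?g (Suc (Suc i), j) = Some y
        \<or> Suc i = j \<and> y \<in> e (Suc i) \<longrightarrow> x < y)"
      using B by (meson le_less_trans)
  qed
  ultimately show ?case using jn south.prems by (intro south.IH) auto
qed



lemma tab_bounded: "tab n D T \<Longrightarrow> bounded n T"
  by (auto simp: tab_def bounded_def)

section \<open>The order of slides: passes over rows\<close>

text \<open>Rows extend without bound and start left of the diagonal. Labels live in the triangle
  anyway, and in return \<open>insert_inner\<close> holds without side conditions.\<close>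

definition inner :: "nat \<Rightarrow> nat \<Rightarrow> (nat \<times> nat) set" where
  "inner k j = {(p, q). p < k \<or> p = k \<and> q < j}"

lemma insert_inner: "insert (k, j) (inner k j) = inner k (Suc j)"
  by (auto simp: inner_def)

lemma slide_tab:
  assumes "tab n (inner k (Suc j)) T" "1 \<le> k" "k \<le> j" "j \<le> n"
  shows "tab n (inner k j) (slide k j T)"
proof (rule slides_tab)
  show "slides k j T (slide k j T)" using assms by (intro slides_total tab_bounded)
  show "tab n (insert (k, j) (inner k j)) T" using assms(1) by (simp only: insert_inner)
  show "(k, j) \<notin> inner k j" by (simp add: inner_def)
  show "hole_ok (inner k j) k j T" unfolding hole_ok_def inner_def by auto
qed (use assms in auto)

text \<open>The slides into row \<open>k\<close> from its right end, at columns
  \<open>n, n - 1, \<dots>, j\<close>; \<open>j = Suc n\<close> stands for no slide at all.\<close>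

definition run :: "nat \<Rightarrow> nat \<Rightarrow> nat \<Rightarrow> tableau \<Rightarrow> tableau" where
  "run n k j T = fold (slide k) (rev [j..<Suc n]) T"

text \<open>The complete passes over rows \<open>n, n - 1, \<dots>, k\<close>; for
  \<open>k = 1\<close> this is the rectification.\<close>

definition stage :: "nat \<Rightarrow> nat \<Rightarrow> tableau \<Rightarrow> tableau" where
  "stage n k T = fold (\<lambda>k. run n k k) (rev [k..<Suc n]) T"

lemma run_Suc [simp]: "run n k (Suc n) T = T"
  by (simp add: run_def)

lemma run_rec: "j \<le> n \<Longrightarrow> run n k j T = slide k j (run n k (Suc j) T)"
  by (simp add: run_def upt_conv_Cons del: upt_Suc)

lemma stage_Suc [simp]: "stage n (Suc n) T = T"
  by (simp add: stage_def)

lemma stage_rec: "k \<le> n \<Longrightarrow> stage n k T = run n k k (stage n (Suc k) T)"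
  by (simp add: stage_def upt_conv_Cons del: upt_Suc)

lemma run_tab:
  assumes "tab n (inner k (Suc n)) T" "1 \<le> k" "k \<le> j" "j \<le> Suc n"
  shows "tab n (inner k j) (run n k j T)"
  using assms(4,3)
proof (induction rule: inc_induct)
  case base
  then show ?case using assms by simp
next
  case (step j)
  then show ?case using assms(2) by (simp add: run_rec slide_tab)
qed

text \<open>The two inner shapes differ only in row \<open>k\<close> beyond column \<open>n\<close>
  and in row \<open>Suc k\<close> left of the diagonal, where no label can be.\<close>

lemma tab_inner_shift:
  assumes "tab n (inner (Suc k) (Suc k)) T" "k \<le> n"
  shows "tab n (inner k (Suc n)) T"
proof -
  obtain f e where T: "T = (f, e)" by (cases T)
  note t = tabD[OF assms(1)[unfolded T]]
  show ?thesis unfolding T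
    apply (rule tabI)
    subgoal for i j b using t(1)[of i j b] by (auto simp: inner_def)
    subgoal for i j b using t(1)[of i "Suc j" b] t(2)[of i j b] by (auto simp: inner_def)
    subgoal for i j b using t(1)[of "Suc i" j b] t(3)[of i j b] by (auto simp: inner_def)
    subgoal using t(4) by blast
    subgoal for i s using t(4)[of s i] t(5)[of s i] by (auto simp: inner_def)
    subgoal using t(6) by blast
    subgoal using t(7) by blast
    subgoal using t(8) by blast
    subgoal using t(9) by blast
    done
qed

lemma stage_tab:
  assumes "tab n (inner (Suc n) (Suc n)) T" "1 \<le> k" "k \<le> Suc n"
  shows "tab n (inner k k) (stage n k T)"
  using assms(3,2)
proof (induction rule: inc_induct)
  case base
  then show ?case using assms by simp
next
  case (step k)
  then show ?case by (simp add: stage_rec run_tab tab_inner_shift)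
qed

lemma slide_bounded: "bounded n T \<Longrightarrow> k \<le> j \<Longrightarrow> j \<le> n \<Longrightarrow> bounded n (slide k j T)"
  using slides_bounded slides_total by blast

lemma run_bounded:
  assumes "bounded n T" "k \<le> j" "j \<le> Suc n"
  shows "bounded n (run n k j T)"
  using assms(3,2)
proof (induction rule: inc_induct)
  case base
  then show ?case using assms by simp
next
  case (step j)
  then show ?case by (simp add: run_rec slide_bounded)
qed

lemma stage_bounded:
  assumes "bounded n T" "k \<le> Suc n"
  shows "bounded n (stage n k T)"
  using assms(2)
proof (induction rule: inc_induct)
  case base
  then show ?case using assms by simp
next
  case (step k)
  then show ?case by (simp add: stage_rec run_bounded)
qed

lemma slide_frame:
  assumes "bounded n T" "k \<le> j"
  shows "p < k \<or> q < j \<Longrightarrow> fst (slide k j T) (p, q) = fst T (p, q)"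
    and "p < j \<Longrightarrow> snd (slide k j T) p = snd T p"
  using slides_frame[OF slides_total[OF assms]] by blast+

lemma run_frame:
  assumes "bounded n T" "k \<le> j" "j \<le> Suc n"
  shows "(p < k \<or> q < j \<longrightarrow> fst (run n k j T) (p, q) = fst T (p, q)) \<and>
    (p < j \<longrightarrow> snd (run n k j T) p = snd T p)"
  using assms(3,2)
proof (induction rule: inc_induct)
  case base
  then show ?case by simp
next
  case (step j)
  have "bounded n (run n k (Suc j) T)" using step assms by (intro run_bounded) auto
  with step show ?case by (simp add: run_rec slide_frame[where n = n])
qed

lemma stage_frame:
  assumes "bounded n T" "k \<le> Suc n"
  shows "(p < k \<longrightarrow> fst (stage n k T) (p, q) = fst T (p, q)) \<and>
    (p < k \<longrightarrow> snd (stage n k T) p = snd T p)"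
  using assms(2)
proof (induction rule: inc_induct)
  case base
  then show ?case by simp
next
  case (step k)
  have "bounded n (stage n (Suc k) T)" using step assms by (intro stage_bounded) auto
  with step run_frame[of n _ k k p q] show ?case by (simp add: stage_rec)
qed

lemma run_merge:
  assumes "se_closed R" "\<And>c. j \<le> c \<Longrightarrow> c \<le> n \<Longrightarrow> (k, c) \<in> R" "bounded n T" "k \<le> j" "j \<le> Suc n"
  shows "run n k j (merge R T U) = merge R (run n k j T) U"
  using assms(5,4,2)
proof (induction rule: inc_induct)
  case base
  then show ?case by simp
next
  case (step j)
  have "bounded n (run n k (Suc j) T)" using step assms by (intro run_bounded) auto
  with step assms(1) show ?case by (simp add: run_rec slide_merge)
qed

lemma slides_finite: "slides i j T T' \<Longrightarrow> \<forall>p. finite (snd T p) \<Longrightarrow> \<forall>p. finite (snd T' p)"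
  by (induction rule: slides.induct) auto

text \<open>By the frame property the next corner of row \<open>k\<close> is still empty when its
  slide starts.\<close>

lemma run_labels:
  assumes "bounded n T" "k \<le> j" "j \<le> Suc n" "\<And>c. fst T (k, c) = None" "\<forall>p. finite (snd T p)" "l \<le> j"
  shows "labels l (run n k j T) = labels l T \<and> (\<forall>p. finite (snd (run n k j T) p))"
  using assms(3,2,6)
proof (induction rule: inc_induct)
  case base
  then show ?case using assms by simp
next
  case (step j)
  let ?T = "run n k (Suc j) T"
  have b: "bounded n ?T" using step assms by (intro run_bounded) auto
  have N: "fst ?T (k, j) = None" using run_frame[OF assms(1), of k "Suc j" k j] step assms(4) by simp
  have s: "slides k j ?T (slide k j ?T)" using step b by (intro slides_total) auto
  have "labels l (slide k j ?T) = labels l ?T"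
    using step N by (intro slides_labels[OF s]) auto
  with slides_finite[OF s] step show ?case by (simp add: run_rec)
qed

lemma stage_labels:
  assumes "bounded n T" "k \<le> Suc n" "\<And>p q. p \<le> n \<Longrightarrow> fst T (p, q) = None" "\<forall>p. finite (snd T p)" "l \<le> k"
  shows "labels l (stage n k T) = labels l T \<and> (\<forall>p. finite (snd (stage n k T) p))"
  using assms(2,5)
proof (induction rule: inc_induct)
  case base
  then show ?case using assms by simp
next
  case (step k)
  let ?T = "stage n (Suc k) T"
  have b: "bounded n ?T" using step assms by (intro stage_bounded) auto
  have N: "fst ?T (k, c) = None" for c
    using stage_frame[OF assms(1), of "Suc k" k c] step assms(3) by simp
  show ?case using run_labels[OF b, of k k l] N step by (simp add: stage_rec)
qed

section \<open>Passes over a full row\<close>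

definition seg :: "nat \<Rightarrow> nat \<Rightarrow> nat \<Rightarrow> (nat \<Rightarrow> nat) \<Rightarrow> (nat \<times> nat \<rightharpoonup> nat) \<Rightarrow> (nat \<times> nat \<rightharpoonup> nat)" where
  "seg k a b x g = (\<lambda>(p, q). if p = k \<and> a \<le> q \<and> q < b then Some (x q) else g (p, q))"

lemma seg_apply: "seg k a b x g (p, q) = (if p = k \<and> a \<le> q \<and> q < b then Some (x q) else g (p, q))"
  by (simp add: seg_def)

lemma seg_empty [simp]: "b \<le> a \<Longrightarrow> seg k a b x g = g"
  by (auto simp: seg_def fun_eq_iff)

lemma seg_bounded: "bounded n (g, e) \<Longrightarrow> k \<le> a \<Longrightarrow> b \<le> Suc n \<Longrightarrow> bounded n (seg k a b x g, d)"
  by (force simp: bounded_def seg_def split: if_splits)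

lemma se_closed_quadrant: "se_closed {(i, j). p \<le> i \<and> q \<le> j}"
  by (auto simp: se_closed_def)

text \<open>An overlay above or left of the quadrant of the slide is neither read nor changed, so it
  commutes with the slide.\<close>

lemma slide_seg:
  assumes "bounded n (g, e)" "p \<le> q" "q \<le> n" "k < p \<or> b \<le> q"
  shows "slide p q (seg k a b x g, e) = (seg k a b x (fst (slide p q (g, e))), snd (slide p q (g, e)))"
proof -
  let ?R = "{(i, j). p \<le> i \<and> q \<le> j}" and ?U = "(seg k a b x g, e)" and ?W = "slide p q (g, e)"
  note fr = slide_frame[OF assms(1,2)]
  have "?U = merge ?R (g, e) ?U"
    using assms(4) by (auto simp: merge_def seg_def fun_eq_iff)
  then have "slide p q ?U = slide p q (merge ?R (g, e) ?U)" by simp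
  also have "\<dots> = merge ?R ?W ?U"
    by (rule slide_merge[OF se_closed_quadrant _ assms(1)]) (use assms in auto)
  also have "\<dots> = (seg k a b x (fst ?W), snd ?W)"
  proof -
    have "fst ?W (i, j) = g (i, j)" if "(i, j) \<notin> ?R" for i j
      using fr(1)[of i j] that by auto
    moreover have "snd ?W i = e i" if "(i, i) \<notin> ?R" for i
      using fr(2)[of i] that assms(2) by auto
    ultimately show ?thesis using assms(4)
      by (auto simp: merge_def seg_def fun_eq_iff)
  qed
  finally show ?thesis .
qed

lemma slide_south:
  assumes "bounded n (f, e)" "i < j" "f (Suc i, j) = Some b" "\<And>a. f (i, Suc j) = Some a \<Longrightarrow> b < a"
  shows "slide i j (f, e) = slide (Suc i) j (f((i, j) \<mapsto> b, (Suc i, j) := None), e)"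
  using assms by (subst slide.simps) (auto split: option.splits)

text \<open>Each slide first lifts the label directly below, because that label is smaller than its
  former eastern neighbour, already lifted. The hole then continues from row \<open>Suc k\<close>
  exactly as a pass over row \<open>Suc k\<close> would if the full row were absent.\<close>

lemma run_full_row:
  assumes g: "bounded n (g, e)" "\<And>p q. p \<le> Suc k \<Longrightarrow> g (p, q) = None"
    and x: "\<And>c. k < c \<Longrightarrow> c < n \<Longrightarrow> x c < x (Suc c)"
    and j: "k < j" "j \<le> Suc n"
  defines "W \<equiv> \<lambda>j. run n (Suc k) j (g, e)"
  shows "run n k j (seg (Suc k) (Suc k) (Suc n) x g, e) =
    (seg k j (Suc n) x (seg (Suc k) (Suc k) j x (fst (W j))), snd (W j))"
  using j(2,1)
proof (induction rule: inc_induct)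
  case base
  then show ?case by (simp add: W_def)
next
  case (step j)
  let ?h = "fst (W (Suc j))" and ?d = "snd (W (Suc j))"
  have b: "bounded n (W (Suc j))" unfolding W_def using step by (intro run_bounded[OF g(1)]) auto
  then have b': "bounded n (?h, ?d)" by simp
  have h: "?h (p, q) = None" if "p < Suc k \<or> p = Suc k \<and> q \<le> j" for p q
    using run_frame[OF g(1), of "Suc k" "Suc j" p q] that step g(2) by (auto simp: W_def)
  let ?s = "\<lambda>a b. seg k a (Suc n) x (seg (Suc k) (Suc k) b x ?h)"
  have b1: "bounded n (seg (Suc k) (Suc k) c x ?h, d)" if "c \<le> Suc n" for c d
    using b' that by (intro seg_bounded[where e = ?d]) auto
  have b2: "bounded n (?s (Suc j) (Suc j), ?d)"
    using b1 step by (intro seg_bounded[OF b1]) auto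
  have "run n k j (seg (Suc k) (Suc k) (Suc n) x g, e) = slide k j (?s (Suc j) (Suc j), ?d)"
    using step by (simp add: run_rec)
  \<comment> \<open>East of the bullet stands \<open>x (Suc j)\<close> or, in column
    \<open>n\<close>, nothing; \<open>x j\<close> below it is smaller.\<close>
  also have "\<dots> = slide (Suc k) j ((?s (Suc j) (Suc j))((k, j) \<mapsto> x j, (Suc k, j) := None), ?d)"
  proof (rule slide_south[OF b2])
    show "?s (Suc j) (Suc j) (Suc k, j) = Some (x j)" using step by (simp add: seg_apply)
    show "x j < a" if "?s (Suc j) (Suc j) (k, Suc j) = Some a" for a
      using that h[of k "Suc j"] x[of j] step by (simp add: seg_apply split: if_splits)
  qed (use step in auto)
  also have "(?s (Suc j) (Suc j))((k, j) \<mapsto> x j, (Suc k, j) := None) = ?s j j"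
  proof
    fix p :: "nat \<times> nat"
    obtain a b where p: "p = (a, b)" by (cases p)
    show "((?s (Suc j) (Suc j))((k, j) \<mapsto> x j, (Suc k, j) := None)) p = ?s j j p"
      using h[of "Suc k" j] step unfolding p by (auto simp: seg_apply)
  qed
  \<comment> \<open>The lifted part of the row lies above, and the part still to be lifted lies west
    of, the remaining slide; both overlays are taken out in turn.\<close>
  also have "slide (Suc k) j (?s j j, ?d) =
      (seg k j (Suc n) x (fst (slide (Suc k) j (seg (Suc k) (Suc k) j x ?h, ?d))),
       snd (slide (Suc k) j (seg (Suc k) (Suc k) j x ?h, ?d)))"
    using step by (intro slide_seg[OF b1]) auto
  also have "slide (Suc k) j (seg (Suc k) (Suc k) j x ?h, ?d) =
      (seg (Suc k) (Suc k) j x (fst (slide (Suc k) j (?h, ?d))), snd (slide (Suc k) j (?h, ?d)))"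
    using step by (intro slide_seg[OF b']) auto
  also have "slide (Suc k) j (?h, ?d) = W j" using step by (simp add: W_def run_rec)
  finally show ?case by simp
qed

corollary run_full_row_last:
  assumes "bounded n (g, e)" "\<And>p q. p \<le> Suc k \<Longrightarrow> g (p, q) = None"
    and "\<And>c. k < c \<Longrightarrow> c < n \<Longrightarrow> x c < x (Suc c)" "k < n"
  defines "W \<equiv> run n (Suc k) (Suc k) (g, e)"
  shows "run n k k (seg (Suc k) (Suc k) (Suc n) x g, e) =
    slide k k (seg k (Suc k) (Suc n) x (fst W), snd W)"
  using run_full_row[where g = g and x = x and j = "Suc k", OF assms(1-3)] assms(4) by (simp add: W_def run_rec)

lemma slide_diag_edge:
  assumes "bounded n (g, e)" "k < n" "e k \<noteq> {}" "Min (e k) \<le> x (Suc k)"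
  shows "slide k k (seg k (Suc k) (Suc n) x g, e) =
    (seg k k (Suc n) (x(k := Min (e k))) g, e(k := e k - {Min (e k)}))"
proof -
  have "slide k k (seg k (Suc k) (Suc n) x g, e) =
      ((seg k (Suc k) (Suc n) x g)((k, k) \<mapsto> Min (e k)), e(k := e k - {Min (e k)}))"
    using assms by (subst slide.simps) (auto simp: seg_apply)
  also have "(seg k (Suc k) (Suc n) x g)((k, k) \<mapsto> Min (e k)) = seg k k (Suc n) (x(k := Min (e k))) g"
    using assms(2) by (auto simp: seg_def fun_eq_iff)
  finally show ?thesis .
qed

lemma slide_diag_east:
  assumes "bounded n (g, e)" "k < n" "e k = {} \<or> x (Suc k) < Min (e k)"
  shows "slide k k (seg k (Suc k) (Suc n) x g, e) =
    slide k (Suc k) ((seg k (Suc k) (Suc n) x g)((k, k) \<mapsto> x (Suc k), (k, Suc k) := None), e)"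
  using assms by (subst slide.simps) (auto simp: seg_apply)

text \<open>The bullet goes one box east and then south: \<open>x (Suc k)\<close> moves to the
  diagonal and \<open>z\<close> takes its place. The rest of the slide starts at the diagonal box
  that \<open>z\<close> has vacated.\<close>

lemma slide_diag_east_south:
  assumes g: "bounded n (g, e)" and k: "k < n" and E: "e k = {} \<or> x (Suc k) < Min (e k)"
    and z: "g (Suc k, Suc k) = Some z" "Suc k < n \<Longrightarrow> z < x (Suc (Suc k))" and r: "\<And>p q. p \<le> k \<Longrightarrow> g (p, q) = None"
  defines "V \<equiv> slide (Suc k) (Suc k) (g((Suc k, Suc k) := None), e)"
  shows "slide k k (seg k (Suc k) (Suc n) x g, e) =
    (seg k k (Suc n) (x(k := x (Suc k), Suc k := z)) (fst V), snd V)"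
proof -
  let ?f = "(seg k (Suc k) (Suc n) x g)((k, k) \<mapsto> x (Suc k), (k, Suc k) := None)"
  have b: "bounded n (?f, e)"
  proof -
    have "bounded n (seg k (Suc k) (Suc n) x g, e)" using g by (intro seg_bounded) auto
    then show ?thesis using k by (auto simp: bounded_def)
  qed
  have b': "bounded n (g((Suc k, Suc k) := None), e)" using g by (auto simp: bounded_def)
  have "slide k k (seg k (Suc k) (Suc n) x g, e) = slide k (Suc k) (?f, e)"
    using g k E by (rule slide_diag_east)
  also have "\<dots> = slide (Suc k) (Suc k) (?f((k, Suc k) \<mapsto> z, (Suc k, Suc k) := None), e)"
  proof (rule slide_south[OF b])
    show "?f (Suc k, Suc k) = Some z" using z(1) by (simp add: seg_apply)
    show "z < a" if "?f (k, Suc (Suc k)) = Some a" for a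
      using that z(2) r[of k "Suc (Suc k)"] by (auto simp: seg_apply split: if_splits)
  qed simp
  also have "?f((k, Suc k) \<mapsto> z, (Suc k, Suc k) := None) =
      seg k k (Suc n) (x(k := x (Suc k), Suc k := z)) (g((Suc k, Suc k) := None))"
    using k by (auto simp: seg_def fun_eq_iff)
  also have "slide (Suc k) (Suc k) (\<dots>, e) = (seg k k (Suc n) (x(k := x (Suc k), Suc k := z)) (fst V), snd V)"
    unfolding V_def using k by (intro slide_seg[OF b']) auto
  finally show ?thesis .
qed

section \<open>Block placements\<close>

text \<open>
  In \<open>block_placement y d k a E\<close>, columns \<open>k\<close> to \<open>k + d\<close> remain to be treated and \<open>a\<close> is the label of the
  start of the block containing \<open>k\<close>.  The first disjunct ends this block at column \<open>k\<close>, the second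
  continues it.  If the block started before \<open>k\<close>, then \<open>y k\<close> is still on edge \<open>k\<close> after the pass
  over row \<open>k\<close>.
\<close>

definition leftover :: "(nat \<Rightarrow> nat) \<Rightarrow> nat \<Rightarrow> nat \<Rightarrow> nat set" where
  "leftover y k a = (if a = y k then {} else {y k})"

fun block_placement :: "(nat \<Rightarrow> nat) \<Rightarrow> nat \<Rightarrow> nat \<Rightarrow> nat \<Rightarrow> (nat \<Rightarrow> nat set) \<Rightarrow> bool" where
  "block_placement y 0 k a E \<longleftrightarrow> E k = insert a (leftover y k a)"
| "block_placement y (Suc d) k a E \<longleftrightarrow>
     E k = insert a (leftover y k a) \<and> block_placement y d (Suc k) (y (Suc k)) E \<or>
     E k = leftover y k a \<and> block_placement y d (Suc k) a E"

text \<open>A run that stops at column \<open>j\<close> never reaches an edge of smaller index.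
  Labels still waiting on such edges can be exchanged without recomputing the run.\<close>

lemma run_edges:
  assumes "bounded n (g, e)" "p \<le> j" "j \<le> Suc n" "\<And>i. j \<le> i \<Longrightarrow> d i = e i"
  shows "run n p j (g, d) =
    (fst (run n p j (g, e)), \<lambda>i. if i < j then d i else snd (run n p j (g, e)) i)"
proof -
  let ?R = "{(a, b). p \<le> a \<and> j \<le> b}" and ?W = "run n p j (g, e)"
  have "(g, d) = merge ?R (g, e) (g, d)"
    using assms(4) by (auto simp: merge_def fun_eq_iff)
  then have "run n p j (g, d) = run n p j (merge ?R (g, e) (g, d))" by simp
  also have "\<dots> = merge ?R ?W (g, d)"
    by (rule run_merge[OF se_closed_quadrant _ assms(1-3)]) (use assms in auto)
  also have "\<dots> = (fst ?W, \<lambda>i. if i < j then d i else snd ?W i)"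
  proof -
    have "fst ?W (a, b) = g (a, b)" if "\<not> (p \<le> a \<and> j \<le> b)" for a b
      using run_frame[OF assms(1-3), of a b] that by auto
    then show ?thesis using assms(2) by (auto simp: merge_def fun_eq_iff)
  qed
  finally show ?thesis .
qed

lemma slide_edges:
  assumes "bounded n (g, e)" "p \<le> j" "j \<le> n" "\<And>i. j \<le> i \<Longrightarrow> d i = e i"
  shows "slide p j (g, d) =
    (fst (slide p j (g, e)), \<lambda>i. if i < j then d i else snd (slide p j (g, e)) i)"
proof -
  let ?R = "{(a, b). p \<le> a \<and> j \<le> b}" and ?W = "slide p j (g, e)"
  have "(g, d) = merge ?R (g, e) (g, d)"
    using assms(4) by (auto simp: merge_def fun_eq_iff)
  then have "slide p j (g, d) = slide p j (merge ?R (g, e) (g, d))" by simp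
  also have "\<dots> = merge ?R ?W (g, d)"
    by (rule slide_merge[OF se_closed_quadrant _ assms(1-3)]) (use assms in auto)
  also have "\<dots> = (fst ?W, \<lambda>i. if i < j then d i else snd ?W i)"
  proof -
    have "fst ?W (a, b) = g (a, b)" if "\<not> (p \<le> a \<and> j \<le> b)" for a b
      using slide_frame(1)[OF assms(1,2), of a b] that by auto
    then show ?thesis using assms(2) by (auto simp: merge_def fun_eq_iff)
  qed
  finally show ?thesis .
qed

lemma slide_take_edge:
  assumes "e i \<noteq> {}" "\<And>a. f (i, Suc i) = Some a \<Longrightarrow> Min (e i) \<le> a"
  shows "slide i i (f, e) = (f((i, i) \<mapsto> Min (e i)), e(i := e i - {Min (e i)}))"
  using assms by (intro slides_slide slides.edge)

lemma Min_eq_insert: "finite A \<Longrightarrow> (\<And>x. x \<in> A \<Longrightarrow> (a::nat) < x) \<Longrightarrow> Min (insert a A) = a"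
  by (intro Min_eqI) (auto intro: less_imp_le)

text \<open>Sufficiency of the block condition, by induction on \<open>d\<close>. In the result the
  small labels lie on top of the tableau \<open>W\<close> that the large labels \<open>e2\<close>
  form on their own from row \<open>Suc k\<close> on.\<close>

lemma stage_block_placement:
  assumes "block_placement y d k a E" "k + d = n" "1 \<le> k" "a \<le> y k" "strict_mono y"
    and e2: "bounded n (Map.empty, e2)" "\<And>i. finite (e2 i)" "\<And>i s. s \<in> e2 i \<Longrightarrow> y n < s"
    and E: "\<And>i. n < i \<Longrightarrow> E i = {}"
  defines "W \<equiv> stage n (Suc k) (Map.empty, e2)"
  shows "stage n k (Map.empty, \<lambda>i. E i \<union> e2 i) =
    (seg k k (Suc n) (y(k := a)) (fst W),
     \<lambda>i. if i < k then E i \<union> e2 i else if i = k then leftover y k a \<union> snd W k else snd W i)"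
  using assms(1-4) unfolding W_def
proof (induction d arbitrary: k a)
  case 0
  have kn: "k = n" using 0 by simp
  let ?e = "\<lambda>i. E i \<union> e2 i"
  have e: "?e n = insert a (leftover y n a \<union> e2 n)" using 0 kn by simp
  have lt: "a < s" if "s \<in> leftover y n a \<union> e2 n" for s
    using that 0 kn e2(3)[of s n] by (auto simp: leftover_def split: if_splits)
  have m: "Min (?e n) = a" unfolding e using e2(2) lt
    by (intro Min_eq_insert) (auto simp: leftover_def)
  have "stage n n (Map.empty, ?e) = slide n n (Map.empty, ?e)" by (simp add: stage_rec run_rec)
  also have "\<dots> = (Map.empty((n, n) \<mapsto> a), ?e(n := ?e n - {a}))"
    using slide_take_edge[of ?e n Map.empty] m e by (simp only:) auto
  also have "?e n - {a} = leftover y n a \<union> e2 n" unfolding e using lt by auto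
  also have "(Map.empty((n, n) \<mapsto> a), ?e(n := \<dots>)) = (seg n n (Suc n) (y(n := a)) Map.empty,
     \<lambda>i. if i < n then E i \<union> e2 i else if i = n then leftover y n a \<union> e2 n else e2 i)"
    using E by (auto simp: seg_def fun_eq_iff)
  finally show ?case unfolding kn stage_Suc fst_conv snd_conv .
next
  case (Suc d)
  have kn: "k < n" "Suc k \<le> n" using Suc.prems by simp_all
  define T where "T = (Map.empty :: nat \<times> nat \<rightharpoonup> nat, \<lambda>i. E i \<union> e2 i)"
  define W' where "W' = stage n (Suc (Suc k)) (Map.empty, e2)"
  define W where "W = stage n (Suc k) (Map.empty, e2)"
  have W: "W = run n (Suc k) (Suc k) W'" using kn by (simp add: W_def W'_def stage_rec)
  have bW': "bounded n (fst W', snd W')" using stage_bounded[OF e2(1)] kn by (simp add: W'_def)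
  have bW: "bounded n (fst W, snd W)" using stage_bounded[OF e2(1)] kn by (simp add: W_def)
  have W'r: "fst W' (p, q) = None" if "p \<le> Suc k" for p q
    using stage_frame[OF e2(1), of "Suc (Suc k)" p q] kn that by (simp add: W'_def)
  have W'e: "snd W' i = e2 i" if "i \<le> Suc k" for i
    using stage_frame[OF e2(1), of "Suc (Suc k)" i] kn that by (simp add: W'_def)
  have We: "snd W i = e2 i" if "i \<le> k" for i
    using stage_frame[OF e2(1), of "Suc k" i] kn that by (simp add: W_def)
  have y: "y i < y j \<longleftrightarrow> i < j" "y i \<le> y j \<longleftrightarrow> i \<le> j" for i j
    using assms(5) by (simp_all add: strict_mono_less strict_mono_less_eq)
  have ay: "a < y (Suc k)" using Suc.prems(4) y(1)[of k "Suc k"] by simp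
  have big: "y n < s" if "s \<in> e2 i" for s i using e2(3) that .
  have lt: "a < s" if "s \<in> leftover y k a \<union> e2 k" for s
    using that Suc.prems(4) big[of s k] y(2)[of k n] kn by (auto simp: leftover_def split: if_splits)
  consider (A) "E k = insert a (leftover y k a)" "block_placement y d (Suc k) (y (Suc k)) E"
    | (B) "E k = leftover y k a" "block_placement y d (Suc k) a E"
    using Suc.prems(1) by auto
  then have "stage n k T = (seg k k (Suc n) (y(k := a)) (fst W),
     \<lambda>i. if i < k then E i \<union> e2 i else if i = k then leftover y k a \<union> snd W k else snd W i)"
  proof cases
    \<comment> \<open>The block ends in column \<open>k\<close>: row \<open>Suc k\<close> starts
      with \<open>y (Suc k)\<close>, no small label is left on edge \<open>Suc k\<close>, and the
      last slide takes \<open>a\<close> from edge \<open>k\<close>.\<close>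
    case A
    define e' where "e' = (\<lambda>i. if i < Suc k then E i \<union> e2 i else if i = Suc k
      then leftover y (Suc k) (y (Suc k)) \<union> snd W' (Suc k) else snd W' i)"
    have st: "stage n (Suc k) T = (seg (Suc k) (Suc k) (Suc n) y (fst W'), e')"
      using Suc.IH[OF A(2)] Suc.prems unfolding T_def W'_def e'_def by simp
    define V where "V = run n (Suc k) (Suc k) (fst W', e')"
    have V: "V = (fst W, \<lambda>i. if i < Suc k then E i \<union> e2 i else snd W i)"
      unfolding V_def using run_edges[OF bW', of "Suc k" "Suc k" e'] kn
      by (auto simp: W e'_def leftover_def fun_eq_iff)
    have Vk: "snd V k = insert a (leftover y k a \<union> e2 k)" using A(1) by (simp add: V)
    have m: "Min (snd V k) = a" unfolding Vk using e2(2) lt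
      by (intro Min_eq_insert) (auto simp: leftover_def)
    have "stage n k T = run n k k (seg (Suc k) (Suc k) (Suc n) y (fst W'), e')"
      using kn st by (simp add: stage_rec)
    also have "\<dots> = slide k k (seg k (Suc k) (Suc n) y (fst V), snd V)"
      unfolding V_def using bW' W'r y kn
      by (intro run_full_row_last) (auto simp: bounded_def)
    also have "\<dots> = (seg k k (Suc n) (y(k := a)) (fst V), (snd V)(k := snd V k - {a}))"
    proof -
      have b: "bounded n (fst V, snd V)" using bW by (simp add: bounded_def V)
      have ne: "snd V k \<noteq> {}" using Vk by simp
      show ?thesis using slide_diag_edge[OF b kn(1) ne, of y] ay unfolding m by simp
    qed
    also have "snd V k - {a} = leftover y k a \<union> snd W k"
      unfolding Vk using lt We[of k] by auto
    also have "(snd V)(k := \<dots>) = (\<lambda>i. if i < k then E i \<union> e2 i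
        else if i = k then leftover y k a \<union> snd W k else snd W i)"
      by (auto simp: V fun_eq_iff)
    finally show ?thesis unfolding V fst_conv .
  next
    \<comment> \<open>The block continues: row \<open>Suc k\<close> starts with \<open>a\<close>,
      while \<open>y (Suc k)\<close> waits on edge \<open>Suc k\<close>. It is picked up beneath the
      lifted row; the last slide then moves \<open>a\<close> to the diagonal and
      \<open>y (Suc k)\<close> up into row \<open>k\<close>.\<close>
    case B
    define e' where "e' = (\<lambda>i. if i < Suc k then E i \<union> e2 i else if i = Suc k
      then leftover y (Suc k) a \<union> snd W' (Suc k) else snd W' i)"
    let ?x = "y(Suc k := a)"
    have st: "stage n (Suc k) T = (seg (Suc k) (Suc k) (Suc n) ?x (fst W'), e')"
      unfolding T_def W'_def e'_def by (rule Suc.IH[OF B(2)]) (use Suc.prems ay in auto)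
    define V where "V = run n (Suc k) (Suc k) (fst W', e')"
    \<comment> \<open>The pass of the large labels over row \<open>Suc k\<close> without its last
      slide, which the small label on edge \<open>Suc k\<close> pre-empts for the moment.\<close>
    define W2 where "W2 = run n (Suc k) (Suc (Suc k)) W'"
    define V2 where "V2 = run n (Suc k) (Suc (Suc k)) (fst W', e')"
    have bW2: "bounded n (fst W2, snd W2)"
      using run_bounded[OF bW', of "Suc k" "Suc (Suc k)"] kn by (simp add: W2_def)
    have W2r: "fst W2 (p, q) = None" if "p \<le> k \<or> p = Suc k \<and> q = Suc k" for p q
      using run_frame[OF bW', of "Suc k" "Suc (Suc k)" p q] kn that W'r[of p q]
      by (auto simp: W2_def)
    have W2e: "snd W2 i = e2 i" if "i \<le> Suc k" for i
      using run_frame[OF bW', of "Suc k" "Suc (Suc k)" i] kn that W'e[of i]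
      by (auto simp: W2_def)
    have V2: "V2 = (fst W2, \<lambda>i. if i < Suc (Suc k) then e' i else snd W2 i)"
    proof -
      have "e' i = snd W' i" if "Suc (Suc k) \<le> i" for i using that by (simp add: e'_def)
      then show ?thesis
        unfolding V2_def W2_def using run_edges[OF bW', of "Suc k" "Suc (Suc k)" e', unfolded prod.collapse] kn by simp
    qed
    have V2k: "snd V2 (Suc k) = insert (y (Suc k)) (e2 (Suc k))"
      using ay W'e[of "Suc k"] by (simp add: V2 e'_def leftover_def)
    have m: "Min (snd V2 (Suc k)) = y (Suc k)" unfolding V2k
    proof (rule Min_eq_insert[OF e2(2)])
      show "y (Suc k) < s" if "s \<in> e2 (Suc k)" for s
        using big[OF that] y(2)[of "Suc k" n] kn by simp
    qed
    \<comment> \<open>All boxes of \<open>W2\<close> carry labels from \<open>e2\<close>, and these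
      exceed \<open>y n\<close>.\<close>
    have W2b: "y (Suc k) \<le> b" if "fst W2 (Suc k, Suc (Suc k)) = Some b" for b
    proof -
      have l: "labels 0 W' = labels 0 (Map.empty, e2) \<and> (\<forall>p. finite (snd W' p))"
        unfolding W'_def using e2 kn by (intro stage_labels) auto
      then have "labels 0 W2 = labels 0 (Map.empty, e2)"
        unfolding W2_def using bW' W'r kn run_labels[of n W' "Suc k" "Suc (Suc k)" 0] by simp
      moreover have "b \<in> labels 0 W2" using that by (auto simp: labels_def ran_def)
      ultimately have "y n < b" using big by (auto simp: labels_def)
      then show ?thesis using y(2)[of "Suc k" n] kn by simp
    qed
    have V: "V = ((fst W2)((Suc k, Suc k) \<mapsto> y (Suc k)), \<lambda>i. if i < Suc k then E i \<union> e2 i else snd W2 i)"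
    proof -
      have "V = slide (Suc k) (Suc k) (fst V2, snd V2)"
        using kn by (simp add: V_def V2_def run_rec)
      also have "\<dots> = ((fst V2)((Suc k, Suc k) \<mapsto> y (Suc k)), (snd V2)(Suc k := snd V2 (Suc k) - {y (Suc k)}))"
        using slide_take_edge[of "snd V2" "Suc k" "fst V2"] m V2k W2b by (simp only: V2 fst_conv) auto
      also have "snd V2 (Suc k) - {y (Suc k)} = e2 (Suc k)"
        unfolding V2k using big[of "y (Suc k)" "Suc k"] y(1)[of n "Suc k"] kn by auto
      finally show ?thesis using W2e[of "Suc k"] by (auto simp: V2 fun_eq_iff e'_def)
    qed
    have bV: "bounded n (fst V, snd V)" using bW2 kn by (auto simp: V bounded_def)
    have Vk: "snd V k = {} \<or> ?x (Suc k) < Min (snd V k)"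
    proof -
      have "snd V k = leftover y k a \<union> e2 k" using B(1) by (simp add: V)
      moreover have "finite \<dots>" using e2(2) by (simp add: leftover_def)
      ultimately have "snd V k = {} \<or> a < Min (snd V k)" using lt by (metis Min_in)
      then show ?thesis by simp
    qed
    have "stage n k T = run n k k (seg (Suc k) (Suc k) (Suc n) ?x (fst W'), e')"
      using kn st by (simp add: stage_rec)
    also have "\<dots> = slide k k (seg k (Suc k) (Suc n) ?x (fst V), snd V)"
      unfolding V_def
    proof (rule run_full_row_last)
      show "?x c < ?x (Suc c)" if "k < c" "c < n" for c
        using that ay y(1)[of "Suc k" "Suc c"] y(1)[of c "Suc c"] by auto
    qed (use bW' W'r kn in \<open>auto simp: bounded_def\<close>)
    also have "\<dots> = (seg k k (Suc n) (?x(k := ?x (Suc k), Suc k := y (Suc k)))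
        (fst (slide (Suc k) (Suc k) ((fst V)((Suc k, Suc k) := None), snd V))),
        snd (slide (Suc k) (Suc k) ((fst V)((Suc k, Suc k) := None), snd V)))"
      using W2r y(1)[of "Suc k" "Suc (Suc k)"]
      by (intro slide_diag_east_south[where x = ?x, OF bV kn(1)] Vk) (auto simp: V)
    also have "(fst V)((Suc k, Suc k) := None) = fst W2"
      using W2r[of "Suc k" "Suc k"] by (auto simp: V fun_eq_iff)
    \<comment> \<open>The vacated box \<open>(Suc k, Suc k)\<close> catches up on the pre-empted
      slide of the large labels, which completes \<open>W\<close>.\<close>
    also have "slide (Suc k) (Suc k) (fst W2, snd V) = (fst W, \<lambda>i. if i < Suc k then E i \<union> e2 i else snd W i)"
      using slide_edges[OF bW2, of "Suc k" "Suc k" "snd V"] kn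
      by (auto simp: V W W2_def run_rec fun_eq_iff)
    also have "?x(k := ?x (Suc k), Suc k := y (Suc k)) = y(k := a)" by auto
    finally have "stage n k T = (seg k k (Suc n) (y(k := a)) (fst W),
        \<lambda>i. if i < Suc k then E i \<union> e2 i else snd W i)"
      unfolding fst_conv snd_conv .
    also have "(\<lambda>i. if i < Suc k then E i \<union> e2 i else snd W i) = (\<lambda>i. if i < k then E i \<union> e2 i
        else if i = k then leftover y k a \<union> snd W k else snd W i)"
      using B(1) We[of k] by (auto simp: fun_eq_iff less_Suc_eq)
    finally show ?thesis .
  qed
  then show ?case unfolding T_def W_def .
qed

section \<open>Necessity of block placements\<close>

lemma tab_column_le:
  assumes "tab n (inner m m) (f, e)" "f (p, q) = Some b"
  shows "m \<le> p \<and> (\<exists>a\<le>b. f (m, q) = Some a \<and> (m < p \<longrightarrow> a < b))"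
proof -
  note t = tabD[OF assms(1)]
  have "m \<le> p" using t(1)[OF assms(2)] by (auto simp: inner_def)
  then show ?thesis using assms(2)
  proof (induction p arbitrary: b rule: dec_induct)
    case base
    then show ?case by auto
  next
    case (step p)
    have "(p, q) \<notin> inner m m" using step t(1)[OF step.prems] by (auto simp: inner_def)
    then obtain a where "a < b" "f (p, q) = Some a" using t(3)[OF step.prems] by auto
    with step.IH[of a] show ?case using step.hyps by (meson le_SucI le_less_trans less_imp_le)
  qed
qed

lemma tab_row_le:
  assumes "tab n (inner m m) (f, e)" "f (m, q) = Some b" "m \<le> c" "c \<le> q"
  shows "\<exists>a\<le>b. f (m, c) = Some a \<and> (c < q \<longrightarrow> a < b)"
proof -
  note t = tabD[OF assms(1)]
  show ?thesis using assms(4,2)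
  proof (induction q arbitrary: b rule: dec_induct)
    case base
    then show ?case by auto
  next
    case (step q)
    have "m \<le> q" "(m, q) \<notin> inner m m" using step assms(3) by (auto simp: inner_def)
    then obtain a where "a < b" "f (m, q) = Some a" using t(2)[OF step.prems] by auto
    with step.IH[of a] show ?case by (meson le_less_trans less_imp_le)
  qed
qed

text \<open>Labels move west or north, or from an edge into the box above it, so nothing enters the
  last column from elsewhere.\<close>

lemma slides_column_empty:
  "slides i j T T' \<Longrightarrow> bounded n T \<Longrightarrow> i \<le> j \<Longrightarrow> j \<le> n \<Longrightarrow> \<forall>p. fst T (p, n) = None \<Longrightarrow> snd T n = {}
    \<Longrightarrow> (\<forall>p. fst T' (p, n) = None) \<and> snd T' n = {}"
proof (induction rule: slides.induct)
  case (east f i j a e T)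
  then have b: "i \<le> Suc j" "Suc j \<le> n" "Suc j \<noteq> n" by (auto simp: bounded_def)
  then show ?case using east.prems by (intro east.IH) (auto simp: bounded_def)
next
  case (south i j f b e T)
  then have "Suc i \<le> j" "j \<le> n" "j \<noteq> n" by (auto simp: bounded_def)
  then show ?case using south.prems by (intro south.IH) (auto simp: bounded_def)
qed auto

lemma run_column_empty:
  assumes "bounded n T" "k \<le> j" "j \<le> Suc n" "\<forall>p. fst T (p, n) = None" "snd T n = {}"
  shows "(\<forall>p. fst (run n k j T) (p, n) = None) \<and> snd (run n k j T) n = {}"
  using assms(3,2)
proof (induction rule: inc_induct)
  case base
  then show ?case using assms by simp
next
  case (step j)
  have b: "bounded n (run n k (Suc j) T)" using step assms by (intro run_bounded) auto
  then show ?case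
    using slides_column_empty[OF slides_total[OF b, of k j] b] step by (simp add: run_rec)
qed

text \<open>Either the bullet stays in row \<open>i\<close> and leaves its final box empty, or it
  goes south and pulls up a label of row \<open>Suc i\<close>. In both cases row \<open>i\<close>
  does not end as a full row of labels up to \<open>N\<close>.\<close>

lemma slides_row_gap:
  "slides i j T T' \<Longrightarrow> bounded n T \<Longrightarrow> i < j \<Longrightarrow> j \<le> n \<Longrightarrow> fst T (i, j) = None
    \<Longrightarrow> \<forall>c s. fst T (Suc i, c) = Some s \<longrightarrow> N < s
    \<Longrightarrow> \<exists>c\<ge>j. c \<le> n \<and> (\<forall>s. fst T' (i, c) = Some s \<longrightarrow> N < s)"
proof (induction rule: slides.induct)
  case (east f i j a e T)
  have b: "i < Suc j" "Suc j \<le> n" using east.hyps east.prems by (auto simp: bounded_def)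
  have "\<exists>c\<ge>Suc j. c \<le> n \<and> (\<forall>s. fst T (i, c) = Some s \<longrightarrow> N < s)"
    using east.prems b by (intro east.IH) (auto simp: bounded_def)
  then show ?case using Suc_leD by blast
next
  case (south i j f b e T)
  have "fst T (i, j) = Some b" using slides_frame[OF south.hyps(4), of i j] by auto
  then show ?case using south.prems south.hyps(2) by (intro exI[of _ j]) auto
qed auto

lemma tab_drop_row:
  assumes "tab n (inner m m) (f, e)"
  shows "tab n (inner m (Suc n)) (\<lambda>(p, q). if p \<le> m then None else f (p, q), e)"
proof -
  note t = tabD[OF assms(1)]
  show ?thesis
    apply (rule tabI)
    subgoal for i j b using t(1)[of i j b] by (auto simp: inner_def split: if_splits)
    subgoal for i j b using t(2)[of i j b] by (auto simp: inner_def split: if_splits)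
    subgoal for i j b using t(1)[of "Suc i" j b] t(3)[of i j b] by (auto simp: inner_def split: if_splits)
    subgoal using t(4) by blast
    subgoal for i s using t(4)[of s i] t(5)[of s i] by (auto simp: inner_def split: if_splits)
    subgoal using t(6) by blast
    subgoal for p q a using t(7)[of p a q] by (auto split: if_splits prod.splits)
    subgoal for p i a using t(8)[of p a i] by (auto split: if_splits prod.splits)
    subgoal using t(9) by blast
    done
qed

text \<open>The converse undoes one pass at a time. The hypotheses describe all small labels in row
  \<open>k\<close> and beyond, and each induction step recovers the same description for row
  \<open>Suc k\<close>. The last slide of the pass, into \<open>(k, k)\<close>, decides between the
  two cases of \<open>block_placement\<close>.\<close>

lemma block_placement_necessary:
  assumes e: "tab n (inner (Suc n) (Suc n)) (Map.empty, e)" and y: "strict_mono y"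
    and k: "k + d = n" "1 \<le> k" "a \<le> y k" and Y: "stage n k (Map.empty, e) = (fY, eY)"
    and row: "\<And>c. k \<le> c \<Longrightarrow> c \<le> n \<Longrightarrow> fY (k, c) = Some ((y(k := a)) c)"
    and only: "\<And>p q s. fY (p, q) = Some s \<Longrightarrow> s \<le> y n \<Longrightarrow> p = k"
    and noedge: "\<And>i s. k < i \<Longrightarrow> s \<in> eY i \<Longrightarrow> y n < s"
    and left: "{s \<in> eY k. s \<le> y n} = leftover y k a"
  shows "block_placement y d k a (\<lambda>i. {s \<in> e i. s \<le> y n})"
  using k Y row only noedge left
proof (induction d arbitrary: k a fY eY)
  case 0
  have kn: "k = n" using 0 by simp
  have st: "stage n n (Map.empty, e) = slide n n (Map.empty, e)" by (simp add: stage_rec run_rec)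
  have ne: "e n \<noteq> {}"
  proof
    assume "e n = {}"
    then have "slide n n (Map.empty, e) = (Map.empty, e)" by (subst slide.simps) simp
    then show False using st 0 kn by auto
  qed
  then have "slide n n (Map.empty, e) = (Map.empty((n, n) \<mapsto> Min (e n)), e(n := e n - {Min (e n)}))"
    by (intro slide_take_edge) auto
  then have "fY = Map.empty((n, n) \<mapsto> Min (e n))" "eY = e(n := e n - {Min (e n)})"
    using st 0 kn by auto
  then have a: "a = Min (e n)" "eY n = e n - {a}" using "0.prems"(5)[of n] kn by auto
  then have "a \<in> e n" using ne tabD(6)[OF e] by simp
  then show ?case using 0 kn a by auto
next
  case (Suc d)
  have kn: "k < n" "Suc k \<le> n" using Suc.prems by simp_all
  have ylt: "y i < y j \<longleftrightarrow> i < j" "y i \<le> y j \<longleftrightarrow> i \<le> j" for i j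
    using y by (simp_all add: strict_mono_less strict_mono_less_eq)
  have ay: "a < y (Suc k)" using Suc.prems(3) ylt(1)[of k "Suc k"] by simp
  have an: "a \<le> y n" using Suc.prems(3) ylt(2)[of k n] kn by simp
  have be: "bounded n (Map.empty, e)" using tab_bounded[OF e] .
  obtain f e' where X: "stage n (Suc k) (Map.empty, e) = (f, e')" by fastforce
  have tX: "tab n (inner (Suc k) (Suc k)) (f, e')"
    using stage_tab[OF e, of "Suc k"] kn X by simp
  have e'k: "e' i = e i" if "i \<le> k" for i
    using stage_frame[OF be, of "Suc k" i] that kn X by simp
  have YX: "(fY, eY) = run n k k (f, e')" using Suc.prems(4) X kn by (simp add: stage_rec)
  \<comment> \<open>If this box were empty, column \<open>n\<close> and its edge would be empty by
    standardness, and the pass would leave \<open>(k, n)\<close> empty too. Hence row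
    \<open>Suc k\<close> is full.\<close>
  have "f (Suc k, n) \<noteq> None"
  proof
    assume N: "f (Suc k, n) = None"
    then have c: "f (p, n) = None" for p
      using tab_column_le[OF tX, of p n] by (cases "f (p, n)") auto
    have "e' n = {}" using tabD(5)[OF tX, of _ n] c kn by (force simp: inner_def)
    then have "fY (k, n) = None"
      using run_column_empty[OF tab_bounded[OF tX], of k k] c kn YX by (metis fst_conv snd_conv less_imp_le le_SucI order_refl)
    then show False using Suc.prems(5)[of n] kn by simp
  qed
  then have full: "\<exists>a. f (Suc k, c) = Some a" if "Suc k \<le> c" "c \<le> n" for c
    using tab_row_le[OF tX _ that] by auto
  define x where "x c = the (f (Suc k, c))" for c
  have x: "f (Suc k, c) = Some (x c)" if "Suc k \<le> c" "c \<le> n" for c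
    using full[OF that] by (auto simp: x_def)
  have xless: "x c < x (Suc c)" if "k < c" "c < n" for c
    using tab_row_le[OF tX x[of "Suc c"], of c] x[of c] that by auto
  define g where "g = (\<lambda>(p, q). if p \<le> Suc k then None else f (p, q))"
  have tg: "tab n (inner (Suc k) (Suc n)) (g, e')"
    using tab_drop_row[OF tX] by (simp add: g_def)
  have fg: "f = seg (Suc k) (Suc k) (Suc n) x g"
  proof
    fix p :: "nat \<times> nat"
    obtain i j where p: "p = (i, j)" by (cases p)
    show "f p = seg (Suc k) (Suc k) (Suc n) x g p"
    proof (cases "i = Suc k \<and> Suc k \<le> j \<and> j \<le> n")
      case True
      then show ?thesis using x[of j] by (simp add: p seg_apply)
    next
      case False
      then show ?thesis using tabD(1)[OF tX, of i j]
        by (cases "f (i, j)") (auto simp: p seg_apply g_def inner_def)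
    qed
  qed
  \<comment> \<open>What happens beneath the lifted row: the pass over row \<open>Suc k\<close>
    applied to the tableau without that row.\<close>
  define V where "V = run n (Suc k) (Suc k) (g, e')"
  have tV: "tab n (inner (Suc k) (Suc k)) (fst V, snd V)"
    using run_tab[OF tg, of "Suc k"] kn by (simp add: V_def)
  have bV: "bounded n (fst V, snd V)" by (rule tab_bounded[OF tV])
  have YV: "(fY, eY) = slide k k (seg k (Suc k) (Suc n) x (fst V), snd V)"
    unfolding V_def YX fg
    by (rule run_full_row_last[OF tab_bounded[OF tg]]) (use xless kn in \<open>auto simp: g_def\<close>)
  have Vr: "fst V (p, q) = None" if "p \<le> k" for p q
    using tabD(1)[OF tV, of p q] that by (cases "fst V (p, q)") (auto simp: inner_def)
  have Ve: "snd V i = e i" if "i \<le> k" for i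
    using run_frame[OF tab_bounded[OF tg], of "Suc k" "Suc k" i] that kn e'k by (simp add: V_def)
  have lV: "labels (Suc k) V = labels (Suc k) (g, e')"
    using run_labels[OF tab_bounded[OF tg], of "Suc k" "Suc k" "Suc k"] tabD(6)[OF tg] kn
    by (simp add: V_def g_def)
  \<comment> \<open>The diagonal box is filled either from edge \<open>k\<close> or from the east by
    the label that row \<open>Suc k\<close> began with.\<close>
  show ?case
  proof (cases "e k \<noteq> {} \<and> Min (e k) \<le> x (Suc k)")
    case True
    then have "(fY, eY) = (seg k k (Suc n) (x(k := Min (e k))) (fst V), (snd V)(k := e k - {Min (e k)}))"
      using slide_diag_edge[OF bV kn(1), of x] YV Ve[of k] by simp
    then have fY: "fY = seg k k (Suc n) (x(k := Min (e k))) (fst V)"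
      and eY: "eY = (snd V)(k := e k - {Min (e k)})" by auto
    have a: "Min (e k) = a" using Suc.prems(5)[of k] kn by (simp add: fY seg_apply)
    have xy: "x c = y c" if "k < c" "c \<le> n" for c
      using Suc.prems(5)[of c] that by (simp add: fY seg_apply)
    have nV: "y n < s" if s: "s \<in> labels (Suc k) V" for s
    proof -
      from s consider p q where "fst V (p, q) = Some s" | i where "Suc k \<le> i" "s \<in> snd V i"
        using in_labels[of s "Suc k" "fst V" "snd V"] by auto
      then show ?thesis
      proof cases
        case 1
        then have "k < p" using Vr[of p q] by (cases "k < p") auto
        then have "fY (p, q) = Some s" using 1 by (simp add: fY seg_apply)
        then show ?thesis using Suc.prems(6)[of p q s] \<open>k < p\<close> by (cases "s \<le> y n") auto
      next
        case 2
        then show ?thesis using Suc.prems(7)[of i s] by (simp add: eY)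
      qed
    qed
    have "block_placement y d (Suc k) (y (Suc k)) (\<lambda>i. {s \<in> e i. s \<le> y n})"
    proof (rule Suc.IH[OF _ _ _ X])
      show "f (Suc k, c) = Some ((y(Suc k := y (Suc k))) c)" if "Suc k \<le> c" "c \<le> n" for c
        using x[OF that] xy[of c] that by simp
      show "p = Suc k" if "f (p, q) = Some s" "s \<le> y n" for p q s
      proof (rule ccontr)
        assume "p \<noteq> Suc k"
        then have "g (p, q) = Some s" using that tabD(1)[OF tX that(1)] by (auto simp: g_def inner_def)
        then show False using nV[of s] that lV by (force simp: in_labels)
      qed
      have E: "y n < s" if "Suc k \<le> i" "s \<in> e' i" for i s
        using nV[of s] that lV by (force simp: in_labels)
      show "y n < s" if "Suc k < i" "s \<in> e' i" for i s using E[of i s] that by simp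
      show "{s \<in> e' (Suc k). s \<le> y n} = leftover y (Suc k) (y (Suc k))"
        using E[of "Suc k"] by (force simp: leftover_def)
    qed (use Suc.prems in auto)
    moreover have "{s \<in> e k. s \<le> y n} = insert a (leftover y k a)"
    proof -
      have "a \<in> e k" using True a tabD(6)[OF e, of k] Min_in[of "e k"] by metis
      then have "e k = insert a (eY k)" by (auto simp: eY a)
      then show ?thesis using Suc.prems(8) an by auto
    qed
    ultimately show ?thesis by simp
  next
    case False
    then have E: "snd V k = {} \<or> x (Suc k) < Min (snd V k)" using Ve[of k] by auto
    define F where "F = (seg k (Suc k) (Suc n) x (fst V))((k, k) \<mapsto> x (Suc k), (k, Suc k) := None)"
    have bF: "bounded n (F, snd V)"
    proof -
      have "bounded n (seg k (Suc k) (Suc n) x (fst V), snd V)" by (intro seg_bounded[OF bV]) auto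
      then show ?thesis using kn by (auto simp: F_def bounded_def)
    qed
    have YF: "(fY, eY) = slide k (Suc k) (F, snd V)"
      using slide_diag_east[where x = x, OF bV kn(1) E] YV by (simp add: F_def)
    have "fY (k, k) = F (k, k)" "eY k = snd V k"
      using slide_frame(1)[OF bF, of k "Suc k" k k] slide_frame(2)[OF bF, of k "Suc k" k] YF[symmetric] by auto
    then have xa: "x (Suc k) = a" and eYk: "eY k = e k"
      using Suc.prems(5)[of k] kn Ve by (auto simp: F_def)
    \<comment> \<open>The bullet, now in \<open>(k, Suc k)\<close>, turns south at once exactly if
      such a \<open>z\<close> exists. Otherwise row \<open>k\<close> would acquire a gap or a large
      label.\<close>
    show ?thesis
    proof (cases "\<exists>z. fst V (Suc k, Suc k) = Some z \<and> (Suc k < n \<longrightarrow> z < x (Suc (Suc k)))")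
      case True
      then obtain z where z: "fst V (Suc k, Suc k) = Some z" "Suc k < n \<Longrightarrow> z < x (Suc (Suc k))" by blast
      define V' where "V' = slide (Suc k) (Suc k) ((fst V)((Suc k, Suc k) := None), snd V)"
      have "(fY, eY) = (seg k k (Suc n) (x(k := x (Suc k), Suc k := z)) (fst V'), snd V')"
        using slide_diag_east_south[where x = x, OF bV kn(1) E z Vr] YV by (simp add: V'_def)
      then have fY: "fY = seg k k (Suc n) (x(k := x (Suc k), Suc k := z)) (fst V')" and eY: "eY = snd V'"
        by auto
      have zy: "z = y (Suc k)" using Suc.prems(5)[of "Suc k"] kn by (simp add: fY seg_apply)
      have xy: "x c = y c" if "Suc k < c" "c \<le> n" for c
        using Suc.prems(5)[of c] that by (simp add: fY seg_apply)
      have bV0: "bounded n ((fst V)((Suc k, Suc k) := None), snd V)" using bV by (auto simp: bounded_def)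
      have V'r: "fst V' (p, q) = None" if "p \<le> k" for p q
        using slide_frame(1)[OF bV0, of "Suc k" "Suc k" p q] Vr[of p q] that by (simp add: V'_def)
      have lV': "labels (Suc k) V' = labels (Suc k) ((fst V)((Suc k, Suc k) := None), snd V)"
        unfolding V'_def using tabD(6)[OF tV]
        by (intro slides_labels[OF slides_total[OF bV0, of "Suc k" "Suc k"]]) auto
      have nV': "y n < s" if s: "s \<in> labels (Suc k) V'" for s
      proof -
        from s consider p q where "fst V' (p, q) = Some s" | i where "Suc k \<le> i" "s \<in> snd V' i"
          using in_labels[of s "Suc k" "fst V'" "snd V'"] by auto
        then show ?thesis
        proof cases
          case 1
          then have "k < p" using V'r[of p q] by (cases "k < p") auto
          then have "fY (p, q) = Some s" using 1 by (simp add: fY seg_apply)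
          then show ?thesis using Suc.prems(6)[of p q s] \<open>k < p\<close> by (cases "s \<le> y n") auto
        next
          case 2
          then show ?thesis using Suc.prems(7)[of i s] by (simp add: eY)
        qed
      qed
      \<comment> \<open>Row \<open>k\<close> has taken only \<open>z\<close> out of
        \<open>V\<close>; everything else in question stays beyond row \<open>k\<close> and must be
        large.\<close>
      have sV: "s = z" if "s \<in> labels (Suc k) (g, e')" "s \<le> y n" for s
      proof (rule ccontr)
        assume "s \<noteq> z"
        have "s \<in> labels (Suc k) (fst V, snd V)" using that(1) lV by simp
        then have "s \<in> labels (Suc k) V'"
          unfolding lV' in_labels using z(1) \<open>s \<noteq> z\<close> by (metis fun_upd_apply option.inject)
        then show False using nV' that(2) by fastforce
      qed
      have zl: "z \<in> labels (Suc k) (g, e')"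
        using z(1) lV in_labels[of z "Suc k" "fst V" "snd V"] by auto
      \<comment> \<open>Boxes below row \<open>Suc k\<close> lie in columns from
        \<open>Suc (Suc k)\<close> on, so their labels exceed \<open>x (Suc (Suc k))\<close> and
        hence \<open>z\<close>. Labels on later edges exceed the boxes above them, so
        \<open>z\<close> can only come from edge \<open>Suc k\<close>.\<close>
      have gz: "z < s" if s: "g (p, q) = Some s" for p q s
      proof -
        have p: "Suc k < p" "f (p, q) = Some s" using s by (auto simp: g_def split: if_splits)
        have q: "p \<le> q" "q \<le> n" using tabD(1)[OF tX p(2)] by auto
        obtain b where b: "b < s" "f (Suc k, q) = Some b" using tab_column_le[OF tX p(2)] p(1) by auto
        have "x (Suc (Suc k)) \<le> b" using tab_row_le[OF tX b(2), of "Suc (Suc k)"] x[of "Suc (Suc k)"] p q by auto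
        then show ?thesis using z(2) b p q by simp
      qed
      have ez: "z < s" if i: "Suc k < i" "s \<in> e' i" for i s
      proof -
        have "i \<le> n" using tabD(4)[OF tX i(2)] .
        then obtain b where "b < s" "f (i, i) = Some b"
          using tabD(5)[OF tX i(2)] i(1) by (auto simp: inner_def)
        then show ?thesis using gz[of i i b] i(1) by (simp add: g_def)
      qed
      have ze: "z \<in> e' (Suc k)"
      proof -
        from zl consider p q where "g (p, q) = Some z" | i where "Suc k \<le> i" "z \<in> e' i"
          by (auto simp: in_labels)
        then show ?thesis
        proof cases
          case 1
          then show ?thesis using gz by blast
        next
          case 2
          then show ?thesis using ez[of i z] by (cases "i = Suc k") auto
        qed
      qed
      have "block_placement y d (Suc k) a (\<lambda>i. {s \<in> e i. s \<le> y n})"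
      proof (rule Suc.IH[OF _ _ _ X])
        show "f (Suc k, c) = Some ((y(Suc k := a)) c)" if "Suc k \<le> c" "c \<le> n" for c
          using x[OF that] xy[of c] that xa by auto
        show "p = Suc k" if "f (p, q) = Some s" "s \<le> y n" for p q s
        proof (rule ccontr)
          assume "p \<noteq> Suc k"
          then have "g (p, q) = Some s" using that tabD(1)[OF tX that(1)] by (auto simp: g_def inner_def)
          then show False using gz[of p q s] sV[of s] that by (force simp: in_labels)
        qed
        show "y n < s" if "Suc k < i" "s \<in> e' i" for i s
          using ez[OF that] sV[of s] that by (force simp: in_labels)
        have "s = z" if "s \<in> e' (Suc k)" "s \<le> y n" for s using sV[of s] that by (force simp: in_labels)
        moreover have "leftover y (Suc k) a = {z}" using ay zy by (simp add: leftover_def)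
        moreover have "z \<le> y n" using zy ylt(2)[of "Suc k" n] kn by simp
        ultimately show "{s \<in> e' (Suc k). s \<le> y n} = leftover y (Suc k) a"
          using ze unfolding set_eq_iff mem_Collect_eq by (metis singleton_iff)
      qed (use Suc.prems ay in auto)
      then show ?thesis using Suc.prems(8) eYk by simp
    next
      case noz: False
      \<comment> \<open>As \<open>x (Suc (Suc k)) \<le> z\<close>, the bullet passes east over
        \<open>z\<close>, which stays in row \<open>Suc k\<close> and so must be large.\<close>
      have "y n < z" if z: "fst V (Suc k, Suc k) = Some z" for z
      proof -
        have lt: "Suc k < n" "x (Suc (Suc k)) \<le> z" using noz z by auto
        define F' where "F' = F((k, Suc k) \<mapsto> x (Suc (Suc k)), (k, Suc (Suc k)) := None)"
        have "(fY, eY) = slide k (Suc (Suc k)) (F', snd V)"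
          unfolding YF F'_def using lt z by (subst slide.simps) (auto simp: F_def seg_apply)
        moreover have "bounded n (F', snd V)" using bF lt by (auto simp: F'_def bounded_def)
        ultimately have "fY (Suc k, Suc k) = F' (Suc k, Suc k)"
          using slide_frame(1)[of n "(F', snd V)" k "Suc (Suc k)" "Suc k" "Suc k"] by (metis fst_conv le_SucI lessI order_refl)
        then have "fY (Suc k, Suc k) = Some z" using z by (simp add: F'_def F_def seg_apply)
        then show ?thesis using Suc.prems(6)[of "Suc k" "Suc k" z] by (cases "z \<le> y n") auto
      qed
      then have "y n < s" if "F (Suc k, c) = Some s" for c s
      proof -
        have V: "fst V (Suc k, c) = Some s" using that by (simp add: F_def seg_apply)
        have "Suc k \<le> c" using tabD(1)[OF tV V] by simp
        then show ?thesis using tab_row_le[OF tV V, of "Suc k"] \<open>\<And>z. fst V (Suc k, Suc k) = Some z \<Longrightarrow> y n < z\<close> by fastforce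
      qed
      \<comment> \<open>All of row \<open>Suc k\<close> is now large, so the slide leaves a gap or a
        large label in row \<open>k\<close>, where some \<open>y c \<le> y n\<close> should
        stand.\<close>
      then have "\<exists>c\<ge>Suc k. c \<le> n \<and> (\<forall>s. fst (slide k (Suc k) (F, snd V)) (k, c) = Some s \<longrightarrow> y n < s)"
        using kn bF by (intro slides_row_gap[OF slides_total[OF bF]]) (auto simp: F_def)
      then obtain c where c: "Suc k \<le> c" "c \<le> n" "\<And>s. fY (k, c) = Some s \<Longrightarrow> y n < s"
        using YF[symmetric] by auto
      then have "y n < y c" using Suc.prems(5)[of c] by auto
      then show ?thesis using ylt(1)[of n c] c(2) by simp
    qed
  qed
qed

section \<open>Counting\<close>

lemma block_placement_cong:
  "(\<And>i. k \<le> i \<Longrightarrow> E i = E' i) \<Longrightarrow> block_placement y d k a E = block_placement y d k a E'"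
proof (induction d arbitrary: k a)
  case (Suc d)
  have "block_placement y d (Suc k) b E = block_placement y d (Suc k) b E'" for b
    using Suc.prems by (intro Suc.IH) auto
  then show ?case using Suc.prems[of k] by simp
qed simp

text \<open>\<open>block_placement\<close> leaves the edges outside columns \<open>k\<close> to
  \<open>k + d\<close> free; fixing them as empty makes the set finite.\<close>

definition placements :: "(nat \<Rightarrow> nat) \<Rightarrow> nat \<Rightarrow> nat \<Rightarrow> nat \<Rightarrow> (nat \<Rightarrow> nat set) set" where
  "placements y d k a = {E. block_placement y d k a E \<and> (\<forall>i. E i \<noteq> {} \<longrightarrow> k \<le> i \<and> i \<le> k + d)}"

lemma placements_0: "placements y 0 k a = {(\<lambda>_. {})(k := insert a (leftover y k a))}"
proof (rule set_eqI)
  fix E :: "nat \<Rightarrow> nat set"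
  have "(\<forall>i. E i \<noteq> {} \<longrightarrow> k \<le> i \<and> i \<le> k + 0) \<longleftrightarrow> (\<forall>i. i \<noteq> k \<longrightarrow> E i = {})"
    by (metis add_0_right le_antisym order_refl)
  then show "E \<in> placements y 0 k a \<longleftrightarrow> E \<in> {(\<lambda>_. {})(k := insert a (leftover y k a))}"
    by (auto simp: placements_def fun_eq_iff)
qed

text \<open>The set on edge \<open>k\<close> is forced in either case, so a placement is determined
  by the case and by its part from column \<open>Suc k\<close> on, whose block starts with
  \<open>y (Suc k)\<close> or still with \<open>a\<close>.\<close>

lemma placements_Suc:
  "placements y (Suc d) k a =
    (\<lambda>E. E(k := insert a (leftover y k a))) ` placements y d (Suc k) (y (Suc k)) \<union>
    (\<lambda>E. E(k := leftover y k a)) ` placements y d (Suc k) a" (is "?L = ?R")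
proof
  have c: "block_placement y d (Suc k) b (E(k := X)) = block_placement y d (Suc k) b E" for b E X
    by (rule block_placement_cong) simp
  show "?L \<subseteq> ?R"
  proof
    fix E
    assume E: "E \<in> ?L"
    let ?E = "E(k := {})"
    have s: "?E i \<noteq> {} \<Longrightarrow> Suc k \<le> i \<and> i \<le> Suc k + d" for i
      using E by (auto simp: placements_def split: if_splits)
    have r: "E = ?E(k := E k)" by simp
    from E consider "E k = insert a (leftover y k a)" "block_placement y d (Suc k) (y (Suc k)) E"
      | "E k = leftover y k a" "block_placement y d (Suc k) a E"
      by (auto simp: placements_def)
    then show "E \<in> ?R"
    proof cases
      case 1
      then have "?E \<in> placements y d (Suc k) (y (Suc k))" using s c by (simp add: placements_def)
      then show ?thesis using r 1(1) by (metis UnI1 image_eqI)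
    next
      case 2
      then have "?E \<in> placements y d (Suc k) a" using s c by (simp add: placements_def)
      then show ?thesis using r 2(1) by (metis UnI2 image_eqI)
    qed
  qed
  have "E(k := X) \<in> ?L"
    if "E \<in> placements y d (Suc k) b" "X = insert a (leftover y k a) \<and> b = y (Suc k) \<or> X = leftover y k a \<and> b = a"
    for E b X
  proof -
    have "k \<le> i \<and> i \<le> k + Suc d" if "(E(k := X)) i \<noteq> {}" for i
      using that \<open>E \<in> _\<close> by (cases "i = k") (auto simp: placements_def dest!: spec[of _ i])
    moreover have "block_placement y (Suc d) k a (E(k := X))"
      using that c by (auto simp: placements_def)
    ultimately show ?thesis by (simp add: placements_def)
  qed
  then show "?R \<subseteq> ?L" by blast
qed

text \<open>Each further column doubles the number. The two images are disjoint because
  \<open>a\<close> lies on edge \<open>k\<close> only if the block ends there, and the maps are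
  injective because placements from \<open>Suc k\<close> on have edge \<open>k\<close>
  empty.\<close>

lemma card_placements: "finite (placements y d k a) \<and> card (placements y d k a) = 2 ^ d"
proof (induction d arbitrary: k a)
  case 0
  then show ?case by (simp add: placements_0)
next
  case (Suc d)
  have inj: "inj_on (\<lambda>E. E(k := X)) (placements y d (Suc k) b)" for X b
  proof (rule inj_onI)
    fix E E' assume "E \<in> placements y d (Suc k) b" "E' \<in> placements y d (Suc k) b"
      and eq: "E(k := X) = E'(k := X)"
    then have "E k = {}" "E' k = {}" by (auto simp: placements_def)
    then show "E = E'" using eq by (metis fun_upd_triv fun_upd_upd)
  qed
  have "a \<notin> leftover y k a" by (simp add: leftover_def)
  then have "(\<lambda>E. E(k := insert a (leftover y k a))) ` A \<inter> (\<lambda>E. E(k := leftover y k a)) ` B = {}" for A B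
    by (auto simp: fun_upd_def dest!: fun_cong[where x = k])
  then show ?case using Suc.IH
    by (simp add: placements_Suc card_Un_disjoint card_image[OF inj])
qed

lemma block_placement_labels:
  assumes "block_placement y d k a E" "k \<le> i" "i \<le> k + d" "s \<in> E i"
  shows "s = a \<or> (\<exists>c. k \<le> c \<and> c \<le> k + d \<and> s = y c)"
  using assms
proof (induction d arbitrary: k a)
  case 0
  then show ?case by (auto simp: leftover_def split: if_splits)
next
  case (Suc d)
  show ?case
  proof (cases "i = k")
    case True
    then show ?thesis using Suc.prems by (auto simp: leftover_def split: if_splits)
  next
    case False
    then have i: "Suc k \<le> i" "i \<le> Suc k + d" using Suc.prems by auto
    obtain b where b: "block_placement y d (Suc k) b E" "b = a \<or> b = y (Suc k)"
      using Suc.prems(1) by auto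
    from Suc.IH[OF b(1) i Suc.prems(4)] consider "s = b" | c where "Suc k \<le> c" "c \<le> Suc k + d" "s = y c"
      by blast
    then show ?thesis
    proof cases
      case 1
      then show ?thesis using b(2) by (metis add_Suc_right le_add1 le_add2 add_Suc Suc_leD le_refl)
    next
      case 2
      then show ?thesis by (intro disjI2 exI[of _ c]) simp
    qed
  qed
qed

text \<open>Edge \<open>k\<close> carries at most \<open>a\<close> and \<open>y k\<close>. Later
  edges carry labels \<open>y c\<close> with \<open>c > k\<close> and, only if the block continues,
  \<open>a\<close>; but then \<open>a\<close> is not on edge \<open>k\<close>.\<close>

lemma block_placement_disjoint:
  assumes "block_placement y d k a E" "strict_mono y" "a \<le> y k"
    "k \<le> i" "i \<le> k + d" "k \<le> j" "j \<le> k + d" "s \<in> E i" "s \<in> E j"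
  shows "i = j"
  using assms
proof (induction d arbitrary: k a)
  case 0
  then show ?case by simp
next
  case (Suc d)
  have ylt: "y p < y q \<longleftrightarrow> p < q" for p q using Suc.prems(2) by (simp add: strict_mono_less)
  have ay: "a < y (Suc k)" using Suc.prems(3) ylt[of k "Suc k"] by simp
  have yk: "y k \<noteq> y c \<and> a \<noteq> y c" if "Suc k \<le> c" for c
    using ylt[of k c] Suc.prems(3) that by auto
  have sep: "s \<notin> E q" if q: "Suc k \<le> q" "q \<le> Suc k + d" "s \<in> E k" for q
  proof
    assume sq: "s \<in> E q"
    from Suc.prems(1) consider
      "E k = insert a (leftover y k a)" "block_placement y d (Suc k) (y (Suc k)) E"
      | "E k = leftover y k a" "block_placement y d (Suc k) a E" by auto
    then show False
    proof cases
      case 1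
      then have "\<exists>c\<ge>Suc k. s = y c" using block_placement_labels[OF 1(2) q(1,2) sq] by auto
      moreover have "s = a \<or> s = y k" using 1(1) q(3) by (auto simp: leftover_def split: if_splits)
      ultimately show False using yk by metis
    next
      case 2
      then have "s = a \<or> (\<exists>c\<ge>Suc k. s = y c)" using block_placement_labels[OF 2(2) q(1,2) sq] by auto
      moreover have "s = y k" "s \<noteq> a" using 2(1) q(3) by (auto simp: leftover_def split: if_splits)
      ultimately show False using yk by metis
    qed
  qed
  show ?case
  proof (cases "i = k \<or> j = k")
    case True
    then show ?thesis using sep[of i] sep[of j] Suc.prems by (metis add_Suc_shift le_antisym not_less_eq_eq)
  next
    case False
    then have "Suc k \<le> i" "Suc k \<le> j" "i \<le> Suc k + d" "j \<le> Suc k + d" using Suc.prems by auto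
    moreover from Suc.prems(1) have "block_placement y d (Suc k) (y (Suc k)) E \<or> block_placement y d (Suc k) a E" by auto
    ultimately show ?thesis using Suc.IH Suc.prems(2,8,9) ay by (metis less_imp_le order_refl)
  qed
qed

section \<open>Removing the first row of the target\<close>

text \<open>The superstandard filling of \<open>m\<close> rows from row \<open>l\<close> on. Row
  \<open>Suc l\<close> starts one column later, so an offset larger by \<open>n - l\<close> lets it
  continue with \<open>c + Suc n\<close> after \<open>c + n\<close>.\<close>

fun target :: "nat \<Rightarrow> nat \<Rightarrow> nat \<Rightarrow> nat \<Rightarrow> (nat \<times> nat \<rightharpoonup> nat)" where
  "target n 0 l c = Map.empty"
| "target n (Suc m) l c = seg l l (Suc n) ((+) c) (target n m (Suc l) (c + (n - l)))"

lemma target_eq: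
  assumes "l + m \<le> Suc n"
  shows "target n m l c (i, j) =
    (if l \<le> i \<and> i < l + m \<and> i \<le> j \<and> j \<le> n then Some (c + (\<Sum>r\<in>{l..<i}. n - r) + j) else None)"
  using assms
proof (induction m arbitrary: l c)
  case 0
  then show ?case by simp
next
  case (Suc m)
  have "(\<Sum>r\<in>{l..<i}. n - r) = (n - l) + (\<Sum>r\<in>{Suc l..<i}. n - r)" if "l < i"
    using that by (rule sum.atLeast_Suc_lessThan)
  then show ?case using Suc by (auto simp: seg_apply)
qed

lemma ran_target:
  assumes "l + m \<le> Suc n"
  shows "ran (target n m l c) = {c + l..<c + l + (\<Sum>i<m. Suc n - l - i)}"
  using assms
proof (induction m arbitrary: l c)
  case 0
  then show ?case by simp
next
  case (Suc m)
  let ?t = "target n m (Suc l) (c + (n - l))"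
  have N: "?t (l, q) = None" for q using Suc.prems by (simp add: target_eq)
  have "ran (target n (Suc m) l c) = (+) c ` {l..n} \<union> ran ?t"
  proof (rule set_eqI)
    fix s
    have r: "s \<in> ran g \<longleftrightarrow> (\<exists>p q. g (p, q) = Some s)" for g :: "nat \<times> nat \<rightharpoonup> nat"
      by (auto simp: ran_def)
    have "s \<in> ran (target n (Suc m) l c) \<longleftrightarrow> (\<exists>p q. target n (Suc m) l c (p, q) = Some s)"
      by (rule r)
    also have "\<dots> \<longleftrightarrow> (\<exists>q\<in>{l..n}. s = c + q) \<or> (\<exists>p q. ?t (p, q) = Some s)"
    proof
      assume "\<exists>p q. target n (Suc m) l c (p, q) = Some s"
      then show "(\<exists>q\<in>{l..n}. s = c + q) \<or> (\<exists>p q. ?t (p, q) = Some s)"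
        by (auto simp: seg_apply split: if_splits)
    next
      assume "(\<exists>q\<in>{l..n}. s = c + q) \<or> (\<exists>p q. ?t (p, q) = Some s)"
      then consider q where "l \<le> q" "q \<le> n" "s = c + q" | p q where "?t (p, q) = Some s" by auto
      then show "\<exists>p q. target n (Suc m) l c (p, q) = Some s"
      proof cases
        case 1
        then have "target n (Suc m) l c (l, q) = Some s" by (simp add: seg_apply)
        then show ?thesis by blast
      next
        case 2
        then have "p \<noteq> l" using N[of q] by auto
        then have "target n (Suc m) l c (p, q) = Some s" using 2 by (simp add: seg_apply)
        then show ?thesis by blast
      qed
    qed
    finally show "s \<in> ran (target n (Suc m) l c) \<longleftrightarrow> s \<in> (+) c ` {l..n} \<union> ran ?t"
      unfolding Un_iff image_iff r .
  qed
  also have "(+) c ` {l..n} = {c + l..<c + Suc n}"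
    by (simp add: atLeastLessThanSuc_atLeastAtMost add.commute)
  also have "ran ?t = {c + Suc n..<c + Suc n + (\<Sum>i<m. Suc n - Suc l - i)}"
    using Suc.IH[of "Suc l" "c + (n - l)"] Suc.prems by simp
  also have "{c + l..<c + Suc n} \<union> \<dots> = {c + l..<c + Suc n + (\<Sum>i<m. Suc n - Suc l - i)}"
    using Suc.prems by (intro ivl_disj_un_two) auto
  also have "c + Suc n + (\<Sum>i<m. Suc n - Suc l - i) = c + l + (\<Sum>i<Suc m. Suc n - l - i)"
    using Suc.prems unfolding sum.lessThan_Suc_shift by simp
  finally show ?case .
qed

text \<open>Start row and offset are parameters so that deleting the first row leads to the same
  notion. The label set is not prescribed; the target forces it.\<close>

definition good :: "nat \<Rightarrow> nat \<Rightarrow> nat \<Rightarrow> nat \<Rightarrow> (nat \<Rightarrow> nat set) set" where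
  "good n m l c = {e. (\<forall>i. finite (e i)) \<and> (\<forall>i. e i \<noteq> {} \<longrightarrow> l \<le> i \<and> i \<le> n) \<and>
     (\<forall>i j. i \<noteq> j \<longrightarrow> e i \<inter> e j = {}) \<and> stage n l (Map.empty, e) = (target n m l c, \<lambda>_. {})}"

text \<open>Slides neither create nor lose labels; all of them start on edges and end in
  boxes.\<close>

lemma good_labels:
  assumes "e \<in> good n m l c" "l \<le> Suc n"
  shows "(\<Union>i. e i) = ran (target n m l c)"
proof -
  have "labels 0 (stage n l (Map.empty, e)) = labels 0 (Map.empty, e)"
    using assms stage_labels[of n "(Map.empty, e)" l 0] by (auto simp: good_def bounded_def)
  then show ?thesis using assms(1) by (simp add: good_def labels_def)
qed

lemma tab_edges:
  assumes "\<forall>i. finite (e i)" "\<forall>i. e i \<noteq> {} \<longrightarrow> i \<le> n" "\<forall>i j. i \<noteq> j \<longrightarrow> e i \<inter> e j = {}"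
  shows "tab n (inner (Suc n) (Suc n)) (Map.empty, e)"
  using assms by (intro tabI) (auto simp: inner_def, blast)

lemma good_0:
  assumes "l \<le> Suc n"
  shows "good n 0 l c = {\<lambda>_. {}}"
proof
  show "good n 0 l c \<subseteq> {\<lambda>_. {}}"
    using good_labels[of _ n 0 l c] assms by fastforce
  let ?T = "stage n l (Map.empty, \<lambda>_. {})"
  have "labels 0 ?T = labels 0 (Map.empty, \<lambda>_. {})"
    using stage_labels[of n "(Map.empty, \<lambda>_. {})" l 0] assms by (auto simp: bounded_def)
  then have L: "s \<notin> labels 0 (fst ?T, snd ?T)" for s by (simp add: labels_def)
  have "fst ?T p = None" for p
    using L in_labels[of _ 0 "fst ?T" "snd ?T"] by (cases "fst ?T p") blast+
  moreover have "snd ?T i = {}" for i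
    using L in_labels[of _ 0 "fst ?T" "snd ?T"] by blast
  ultimately have "?T = (Map.empty, \<lambda>_. {})" by (auto simp: prod_eq_iff fun_eq_iff)
  then show "{\<lambda>_. {}} \<subseteq> good n 0 l c" by (simp add: good_def)
qed

text \<open>Labels up to \<open>y n\<close> make up row \<open>l\<close> of the target and the
  others its remaining rows, so a filling splits uniquely at this threshold. By the two directions
  of the block criterion the lower part is a placement, and the upper part rectifies one row further
  down as if it were alone.\<close>

lemma good_Suc:
  fixes n m l c :: nat
  assumes "1 \<le> l" "l + Suc m \<le> Suc n"
  defines "y \<equiv> (+) c"
  shows "bij_betw (\<lambda>(E, e) i. E i \<union> e i)
    (placements y (n - l) l (y l) \<times> good n m (Suc l) (c + (n - l))) (good n (Suc m) l c)"
proof -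
  let ?P = "placements y (n - l) l (y l)" and ?G = "good n m (Suc l) (c + (n - l))"
  let ?t = "target n m (Suc l) (c + (n - l))"
  let ?W = "\<lambda>e. stage n (Suc l) (Map.empty, e)"
  have ln: "l \<le> n" using assms by simp
  have sm: "strict_mono y" by (simp add: y_def strict_mono_def)
  have t: "target n (Suc m) l c = seg l l (Suc n) y ?t" by (simp add: y_def)
  have big: "y n < s" if "s \<in> ran ?t" for s
    using that assms(2) ln ran_target[of "Suc l" m n "c + (n - l)"] by (auto simp: y_def)
  have bigG: "y n < s" if "e \<in> ?G" "s \<in> e i" for e s i
    using that good_labels[OF that(1)] assms(2) by (intro big) auto
  have smallP: "s \<le> y n" if "E \<in> ?P" "s \<in> E i" for E s i
  proof -
    have "l \<le> i \<and> i \<le> n" using that ln by (auto simp: placements_def)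
    then show ?thesis
      using that block_placement_labels[of y "n - l" l "y l" E i s] ln
      by (auto simp: placements_def y_def)
  qed
  \<comment> \<open>The first block starts in column \<open>l\<close> itself, so its start label is
    \<open>y l\<close> and nothing is left over on edge \<open>l\<close>.\<close>
  have st: "stage n l (Map.empty, \<lambda>i. E i \<union> e i) = (seg l l (Suc n) y (fst (?W e)),
      \<lambda>i. if i < l then E i \<union> e i else snd (?W e) i)"
    if E: "block_placement y (n - l) l (y l) E" "\<And>i. n < i \<Longrightarrow> E i = {}"
      and e: "\<And>i. finite (e i)" "\<And>i s. s \<in> e i \<Longrightarrow> y n < s" for E e
  proof -
    have "stage n l (Map.empty, \<lambda>i. E i \<union> e i) = (seg l l (Suc n) (y(l := y l)) (fst (?W e)),
      \<lambda>i. if i < l then E i \<union> e i else if i = l then leftover y l (y l) \<union> snd (?W e) l else snd (?W e) i)"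
      by (rule stage_block_placement[OF E(1)]) (use assms ln sm E e in \<open>auto simp: bounded_def\<close>)
    then show ?thesis by (auto simp: leftover_def fun_eq_iff)
  qed
  show ?thesis
    unfolding bij_betw_def
  proof
    show "inj_on (\<lambda>(E, e) i. E i \<union> e i) (?P \<times> ?G)"
    proof (rule inj_onI, clarify)
      fix E e E' e'
      assume P: "E \<in> ?P" "E' \<in> ?P" and G: "e \<in> ?G" "e' \<in> ?G"
        and eq: "(\<lambda>i. E i \<union> e i) = (\<lambda>i. E' i \<union> e' i)"
      have "E i = {s \<in> E i \<union> e i. s \<le> y n}" "E' i = {s \<in> E' i \<union> e' i. s \<le> y n}"
        "e i = {s \<in> E i \<union> e i. y n < s}" "e' i = {s \<in> E' i \<union> e' i. y n < s}" for i
        using smallP[OF P(1), of _ i] smallP[OF P(2), of _ i] bigG[OF G(1), of _ i] bigG[OF G(2), of _ i]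
        by fastforce+
      then show "E = E' \<and> e = e'" using fun_cong[OF eq] by (metis ext)
    qed
    show "(\<lambda>(E, e) i. E i \<union> e i) ` (?P \<times> ?G) = good n (Suc m) l c"
    proof (intro equalityI subsetI)
      fix x assume "x \<in> (\<lambda>(E, e) i. E i \<union> e i) ` (?P \<times> ?G)"
      then obtain E e where P: "E \<in> ?P" and G: "e \<in> ?G" and x: "x = (\<lambda>i. E i \<union> e i)" by auto
      have E: "block_placement y (n - l) l (y l) E" "\<And>i. E i \<noteq> {} \<Longrightarrow> l \<le> i \<and> i \<le> n"
        using P ln by (auto simp: placements_def)
      have e: "\<And>i. finite (e i)" "\<And>i. e i \<noteq> {} \<Longrightarrow> Suc l \<le> i \<and> i \<le> n"
        "\<And>i j. i \<noteq> j \<Longrightarrow> e i \<inter> e j = {}" "?W e = (?t, \<lambda>_. {})"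
        using G by (auto simp: good_def)
      have fin: "finite (E i)" for i
      proof (rule finite_subset)
        show "E i \<subseteq> {..y n}" using smallP[OF P] by auto
      qed simp
      have dis: "(E i \<union> e i) \<inter> (E j \<union> e j) = {}" if "i \<noteq> j" for i j
      proof (rule ccontr)
        assume "\<not> ?thesis"
        then obtain s where s: "s \<in> E i \<union> e i" "s \<in> E j \<union> e j" by blast
        show False
        proof (cases "s \<le> y n")
          case True
          then have sE: "s \<in> E i" "s \<in> E j" using s bigG[OF G, of s] by fastforce+
          then have "l \<le> i \<and> i \<le> n" "l \<le> j \<and> j \<le> n" using E(2)[of i] E(2)[of j] by blast+
          then show False using block_placement_disjoint[OF E(1) sm _ _ _ _ _ sE] that by auto
        next
          case False
          then have "s \<in> e i" "s \<in> e j" using s smallP[OF P, of s] by auto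
          then show False using e(3)[OF that] by blast
        qed
      qed
      have stg: "stage n l (Map.empty, x) = (target n (Suc m) l c, \<lambda>_. {})"
      proof -
        have "E i \<union> e i = {}" if "i < l" for i using E(2)[of i] e(2)[of i] that by (cases "E i = {}"; cases "e i = {}") auto
        moreover have "E i = {}" if "n < i" for i using E(2)[of i] that by auto
        ultimately show ?thesis
          unfolding x t using bigG[OF G] by (subst st[OF E(1) _ e(1)]) (auto simp: e(4) fun_eq_iff)
      qed
      have sup: "l \<le> i \<and> i \<le> n" if "x i \<noteq> {}" for i
        using that E(2)[of i] e(2)[of i] unfolding x by (cases "E i = {}") auto
      show "x \<in> good n (Suc m) l c"
        unfolding good_def mem_Collect_eq
      proof (intro conjI allI impI)
        show "finite (x i)" for i using fin e(1) by (simp add: x)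
        show "x i \<inter> x j = {}" if "i \<noteq> j" for i j using dis[OF that] by (simp add: x)
      qed (use sup stg in blast)+
    next
      fix x assume "x \<in> good n (Suc m) l c"
      then have X: "(\<forall>i. finite (x i)) \<and> (\<forall>i. x i \<noteq> {} \<longrightarrow> l \<le> i \<and> i \<le> n) \<and>
        (\<forall>i j. i \<noteq> j \<longrightarrow> x i \<inter> x j = {}) \<and> stage n l (Map.empty, x) = (seg l l (Suc n) y ?t, \<lambda>_. {})"
        unfolding good_def mem_Collect_eq t .
      then have x: "\<forall>i. finite (x i)" "\<And>i. x i \<noteq> {} \<Longrightarrow> l \<le> i \<and> i \<le> n"
        "\<forall>i j. i \<noteq> j \<longrightarrow> x i \<inter> x j = {}" by blast+
      have sx: "stage n l (Map.empty, x) = (seg l l (Suc n) y ?t, \<lambda>_. {})" using X by blast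
      \<comment> \<open>The inverse map cuts every edge set at \<open>y n\<close>, the largest label
        of row \<open>l\<close>.\<close>
      define E where "E = (\<lambda>i. {s \<in> x i. s \<le> y n})"
      define e where "e = (\<lambda>i. {s \<in> x i. y n < s})"
      have xE: "x = (\<lambda>i. E i \<union> e i)" by (auto simp: E_def e_def fun_eq_iff)
      have tx: "tab n (inner (Suc n) (Suc n)) (Map.empty, x)"
        by (rule tab_edges) (use x in auto)
      have E: "block_placement y (n - l) l (y l) E"
        unfolding E_def
      proof (rule block_placement_necessary[OF tx sm _ assms(1) _ sx])
        show "seg l l (Suc n) y ?t (l, q) = Some ((y(l := y l)) q)" if "l \<le> q" "q \<le> n" for q
          using that by (simp add: seg_apply)
        show "p = l" if "seg l l (Suc n) y ?t (p, q) = Some s" "s \<le> y n" for p q s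
        proof (rule ccontr)
          assume "p \<noteq> l"
          then have "s \<in> ran ?t" using that(1) by (auto simp: seg_apply ran_def)
          then show False using big that(2) by fastforce
        qed
      qed (use ln in \<open>auto simp: leftover_def\<close>)
      have fe: "finite (e i)" for i using x(1) by (simp add: e_def)
      have eb: "y n < s" if "s \<in> e i" for s i using that by (simp add: e_def)
      have En: "E i = {}" if "n < i" for i using x(2)[of i] that by (auto simp: E_def)
      \<comment> \<open>Since \<open>E\<close> is a placement, the rectification of \<open>x\<close>
        can be computed a second time; comparing the two results isolates that of the large
        labels.\<close>
      have eq: "seg l l (Suc n) y (fst (?W e)) = seg l l (Suc n) y ?t"
        "(\<lambda>i. if i < l then E i \<union> e i else snd (?W e) i) = (\<lambda>_. {})"
        using st[OF E En fe eb] sx xE by auto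
      have fr: "fst (?W e) (p, q) = None" "snd (?W e) p = e p" if "p < Suc l" for p q
        using stage_frame[of n "(Map.empty, e)" "Suc l" p q] that ln by (simp_all add: bounded_def)
      have tl: "?t (l, q) = None" for q using assms(2) by (simp add: target_eq)
      have "fst (?W e) (p, q) = ?t (p, q)" for p q
        using fun_cong[OF eq(1), of "(p, q)"] fr(1)[of l q] tl[of q]
        by (cases "p = l \<and> l \<le> q \<and> q \<le> n") (auto simp: seg_apply)
      moreover have W2: "snd (?W e) i = {}" for i
        using fun_cong[OF eq(2), of i] fr(2)[of i] by (cases "i < l") auto
      ultimately have W: "?W e = (?t, \<lambda>_. {})" by (auto simp: prod_eq_iff fun_eq_iff)
      \<comment> \<open>Stage \<open>Suc l\<close> cannot reach edge \<open>l\<close>, and this edge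
        ends empty, so it never held a large label.\<close>
      have el: "e l = {}" using fr(2)[of l] W2 by simp
      have es: "Suc l \<le> i \<and> i \<le> n" if "e i \<noteq> {}" for i
      proof -
        have "x i \<noteq> {}" "i \<noteq> l" using that el by (auto simp: e_def)
        then show ?thesis using x(2)[of i] by simp
      qed
      have "e \<in> ?G"
        unfolding good_def mem_Collect_eq
      proof (intro conjI allI impI)
        show "e i \<inter> e j = {}" if "i \<noteq> j" for i j using x(3) that by (auto simp: e_def)
      qed (use fe es W in blast)+
      moreover have "E \<in> ?P"
      proof -
        have "l \<le> i \<and> i \<le> n" if "E i \<noteq> {}" for i
        proof -
          have "x i \<noteq> {}" using that by (auto simp: E_def)
          then show ?thesis using x(2)[of i] by simp
        qed
        then show ?thesis using E ln by (simp add: placements_def)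
      qed
      ultimately show "x \<in> (\<lambda>(E, e) i. E i \<union> e i) ` (?P \<times> ?G)" using xE by auto
    qed
  qed
qed

text \<open>Row \<open>l\<close> contributes one binary choice for each column after
  \<open>l\<close>; every further row has one column fewer.\<close>

lemma card_good:
  assumes "1 \<le> l" "l + m \<le> Suc n"
  shows "card (good n m l c) = 2 ^ (\<Sum>i<m. n - l - i)"
  using assms
proof (induction m arbitrary: l c)
  case 0
  then show ?case by (simp add: good_0)
next
  case (Suc m)
  have "card (good n (Suc m) l c) =
      card (placements ((+) c) (n - l) l (c + l)) * card (good n m (Suc l) (c + (n - l)))"
    using bij_betw_same_card[OF good_Suc[OF Suc.prems]] by (simp add: card_cartesian_product)
  also have "\<dots> = 2 ^ (n - l + (\<Sum>i<m. n - Suc l - i))"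
    using Suc.IH[of "Suc l"] Suc.prems by (simp add: card_placements flip: power_add)
  also have "n - l + (\<Sum>i<m. n - Suc l - i) = (\<Sum>i<Suc m. n - l - i)"
    unfolding sum.lessThan_Suc_shift by simp
  finally show ?case .
qed

section \<open>Southmost corners and the order of the passes\<close>

text \<open>The exact inner shapes met during rectification, in contrast to the unbounded
  \<open>inner\<close>: corners depend on the true boundary.\<close>

definition region :: "nat \<Rightarrow> nat \<Rightarrow> nat \<Rightarrow> (nat \<times> nat) set" where
  "region n k j = {(p, q). 1 \<le> p \<and> p \<le> q \<and> q \<le> n \<and> (p < k \<or> p = k \<and> q \<le> j)}"

lemma southmost_corner_region:
  assumes "1 \<le> k" "k \<le> j" "j \<le> n"
  shows "southmost_corner (region n k j) = (k, j)"
  unfolding southmost_corner_def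
proof (rule the_equality)
  have c: "inner_corner (region n k j) (k, j)"
    using assms by (auto simp: inner_corner_def region_def)
  then show "inner_corner (region n k j) (k, j) \<and>
      (\<forall>c'. inner_corner (region n k j) c' \<longrightarrow> fst c' \<le> fst (k, j))"
    by (auto simp: inner_corner_def region_def)
  fix c
  assume C: "inner_corner (region n k j) c \<and> (\<forall>c'. inner_corner (region n k j) c' \<longrightarrow> fst c' \<le> fst c)"
  obtain p q where pq: "c = (p, q)" by (cases c)
  \<comment> \<open>A second corner may exist at the end of row \<open>k - 1\<close>; comparison
    with the corner \<open>(k, j)\<close> excludes it.\<close>
  have "k \<le> p" using C c pq by force
  then show "c = (k, j)"
    using C assms unfolding pq by (auto simp: inner_corner_def region_def)
qed

lemma region_diff:
  assumes "1 \<le> k" "k \<le> j" "j \<le> n"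
  shows "region n k j - {(k, j)} = region n k (j - 1)"
  using assms by (auto simp: region_def)

text \<open>Column \<open>k - 1\<close> lies left of the diagonal, so row \<open>k\<close> is
  exhausted.\<close>

lemma region_next_row: "1 \<le> k \<Longrightarrow> region n k (k - 1) = region n (k - 1) n"
  by (auto simp: region_def)

lemma rect_step_row:
  assumes "1 \<le> k" "k \<le> n" "t \<le> Suc n - k"
  shows "(rect_step ^^ t) (region n k n, T) = (region n k (n - t), run n k (Suc n - t) T)"
  using assms(3)
proof (induction t)
  case 0
  then show ?case by simp
next
  case (Suc t)
  then have j: "k \<le> n - t" "n - t \<le> n" "Suc n - t = Suc (n - t)" by auto
  have "(rect_step ^^ Suc t) (region n k n, T) = rect_step (region n k (n - t), run n k (Suc n - t) T)"
    using Suc by simp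
  also have "\<dots> = (region n k (n - t - 1), slide k (n - t) (run n k (Suc n - t) T))"
    unfolding rect_step_def jdt_def
    using southmost_corner_region[OF assms(1) j(1,2)] region_diff[OF assms(1) j(1,2)] by simp
  also have "slide k (n - t) (run n k (Suc n - t) T) = run n k (n - t) T"
    using j by (simp add: run_rec)
  finally show ?case by simp
qed

lemma rect_step_stage:
  assumes "1 \<le> k" "k \<le> Suc n"
  shows "(rect_step ^^ (\<Sum>r\<in>{k..<Suc n}. Suc n - r)) (region n n n, T) = (region n (k - 1) n, stage n k T)"
  using assms(2,1)
proof (induction rule: inc_induct)
  case base
  then show ?case by simp
next
  case (step k)
  have "(\<Sum>r\<in>{k..<Suc n}. Suc n - r) = (Suc n - k) + (\<Sum>r\<in>{Suc k..<Suc n}. Suc n - r)"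
    using step.hyps by (intro sum.atLeast_Suc_lessThan) simp
  then have "(rect_step ^^ (\<Sum>r\<in>{k..<Suc n}. Suc n - r)) (region n n n, T) =
      (rect_step ^^ (Suc n - k)) (region n k n, stage n (Suc k) T)"
    using step.IH step.prems by (simp only: funpow_add o_apply) simp
  also have "\<dots> = (region n k (k - 1), run n k k (stage n (Suc k) T))"
    using step rect_step_row[of k n "Suc n - k" "stage n (Suc k) T"] by simp
  also have "\<dots> = (region n (k - 1) n, stage n k T)"
    using step region_next_row[of k n] by (simp add: stage_rec)
  finally show ?case .
qed

section \<open>Staircase shapes and the final count\<close>

lemma sum_list_rho2: "sum_list (take i (rho2 n m)) = (\<Sum>k<min i m. n - k)"
proof -
  have "take i [0..<m] = [0..<min i m]" by (cases "i \<le> m") (auto simp: min_def)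
  then show ?thesis
    by (simp add: rho2_def take_map interv_sum_list_conv_sum_set_nat lessThan_atLeast0)
qed

lemma rho_rho2: "rho n = rho2 n n"
  by (simp add: rho_def rho2_def)

lemma diagram_rho2:
  assumes "m \<le> n"
  shows "diagram (rho2 n m) = {(i, j). 1 \<le> i \<and> i \<le> m \<and> i \<le> j \<and> j \<le> n}"
  using assms by (auto simp: diagram_def rho2_def)

lemma Rect_rho: "Rect (rho n) T = stage n 1 T"
proof -
  have "sum_list (rho n) = (\<Sum>k<n. n - k)"
    using sum_list_rho2[of n n n] by (simp add: rho_rho2 rho2_def)
  also have "\<dots> = (\<Sum>r\<in>{1..<Suc n}. Suc n - r)"
    by (rule sum.reindex_bij_witness[of _ "\<lambda>r. r - 1" Suc]) auto
  finally have s: "sum_list (rho n) = (\<Sum>r\<in>{1..<Suc n}. Suc n - r)" .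
  have "diagram (rho n) = region n n n"
    unfolding rho_rho2 diagram_rho2[OF order_refl] region_def by auto
  then show ?thesis using rect_step_stage[of 1 n T] by (simp add: Rect_def s)
qed

lemma superstandard_rho2:
  assumes "m \<le> n"
  shows "superstandard (rho2 n m) = (target n m 1 0, \<lambda>_. {})"
proof -
  have "(if (i, j) \<in> diagram (rho2 n m) then Some (sum_list (take (i - 1) (rho2 n m)) + (j - i + 1)) else None)
      = target n m 1 0 (i, j)" for i j
  proof (cases "(i, j) \<in> diagram (rho2 n m)")
    case True
    then have ij: "1 \<le> i" "i \<le> m" "i \<le> j" "j \<le> n" using diagram_rho2[OF assms] by auto
    have "(\<Sum>k<i - 1. n - k) = (\<Sum>r\<in>{1..<i}. Suc n - r)"
      by (rule sum.reindex_bij_witness[of _ "\<lambda>r. r - 1" Suc]) auto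
    \<comment> \<open>Row \<open>r\<close> has one box more than the offset increment
      \<open>n - r\<close> in \<open>target\<close>; the surplus \<open>i - 1\<close> combines with
      \<open>j - i + 1\<close> to \<open>j\<close>.\<close>
    also have "\<dots> = (\<Sum>r\<in>{1..<i}. (n - r) + 1)"
      using ij assms by (intro sum.cong) auto
    also have "\<dots> = (\<Sum>r\<in>{1..<i}. n - r) + (i - 1)"
      by (simp only: sum.distrib) simp
    finally show ?thesis using True ij assms by (simp add: sum_list_rho2 target_eq min_absorb1)
  next
    case False
    then show ?thesis using assms by (auto simp: diagram_rho2 target_eq)
  qed
  then show ?thesis by (auto simp: superstandard_def fun_eq_iff)
qed

lemma sum_choose_two:
  assumes "m \<le> n"
  shows "(\<Sum>i<m. n - 1 - i) = (n choose 2) - ((n - m) choose 2)"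
proof -
  \<comment> \<open>The additive form keeps subtraction of binomials out of the induction, whose
    step is the Pascal rule for \<open>Suc k choose 2\<close>.\<close>
  have "(\<Sum>i<m. n - 1 - i) + ((n - m) choose 2) = n choose 2"
    using assms
  proof (induction m)
    case (Suc m)
    then obtain k where k: "n - m = Suc k" by (metis Suc_diff_Suc Suc_le_lessD)
    then have "n - Suc m = k" "n - 1 - m = k" by auto
    moreover have "Suc k choose 2 = k + (k choose 2)" by (simp add: numeral_2_eq_2)
    ultimately show ?case using Suc k by simp
  qed simp
  then show ?thesis by simp
qed

text \<open>The skew shape has no boxes, so all order conditions are void and only the distribution
  over the edges remains.\<close>

lemma SELT_rho:
  "(f, e) \<in> SELT (rho n) (rho n) N \<longleftrightarrow> f = Map.empty \<and> (\<forall>i. e i \<noteq> {} \<longrightarrow> 1 \<le> i \<and> i \<le> n) \<and>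
     (\<Union>i. e i) = {1..N} \<and> (\<forall>i j. i \<noteq> j \<longrightarrow> e i \<inter> e j = {})"
proof -
  have d: "(\<forall>i. e i \<noteq> {} \<longrightarrow> (i, i) \<in> diagram (rho n)) \<longleftrightarrow> (\<forall>i. e i \<noteq> {} \<longrightarrow> 1 \<le> i \<and> i \<le> n)"
    by (auto simp: rho_rho2 diagram_rho2)
  show ?thesis
  proof (cases "f = Map.empty")
    case True
    then show ?thesis unfolding SELT_def mem_Collect_eq prod.case d by simp
  next
    case False
    then have "dom f \<noteq> {}" by simp
    then show ?thesis using False unfolding SELT_def by simp
  qed
qed

theorem theorem3p10:
  fixes n m :: nat
  assumes "m \<le> n" and "n \<ge> 1"
  shows "d_coeff (rho n) (rho2 n m) (rho n) = 2 ^ ((n choose 2) - ((n - m) choose 2))"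
proof -
  let ?N = "sum_list (rho2 n m)"
  have N: "?N = (\<Sum>i<m. n - i)"
    using sum_list_rho2[of m n m] by (simp add: rho2_def)
  \<comment> \<open>Rectification is \<open>stage n 1\<close>, so the tableaux counted are the good
    edge fillings for start row \<open>1\<close>; the offset \<open>0\<close> lets the labels begin
    with \<open>1\<close>.\<close>
  have "{T \<in> SELT (rho n) (rho n) ?N. Rect (rho n) T = superstandard (rho2 n m)} =
      Pair Map.empty ` good n m 1 0" (is "?A = ?B")
  proof (intro equalityI subsetI)
    fix T assume T: "T \<in> ?A"
    obtain f e where fe: "T = (f, e)" by (cases T)
    have "(f, e) \<in> SELT (rho n) (rho n) ?N" using T unfolding fe mem_Collect_eq by (rule conjunct1)
    note S0 = this[unfolded SELT_rho]
    note S = S0[THEN conjunct1] S0[THEN conjunct2, THEN conjunct1]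
      S0[THEN conjunct2, THEN conjunct2, THEN conjunct1] S0[THEN conjunct2, THEN conjunct2, THEN conjunct2]
    have "finite (e i)" for i
      by (rule finite_subset[of _ "{1..?N}"]) (use S(3) in auto)
    moreover have "stage n 1 (Map.empty, e) = (target n m 1 0, \<lambda>_. {})"
      using T S(1) superstandard_rho2[OF assms(1)] by (simp add: fe Rect_rho)
    ultimately have "e \<in> good n m 1 0" using S(2,4) by (simp add: good_def)
    then show "T \<in> ?B" using fe S(1) by simp
  next
    fix T assume "T \<in> ?B"
    then obtain e where fe: "T = (Map.empty, e)" and e: "e \<in> good n m 1 0" by auto
    \<comment> \<open>Conservation of labels supplies the condition on the label set, which
      \<open>good\<close> does not state.\<close>
    have "(\<Union>i. e i) = {1..?N}"
      using good_labels[OF e] ran_target[of 1 m n 0] assms N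
      by (auto simp: atLeastLessThanSuc_atLeastAtMost)
    then have "T \<in> SELT (rho n) (rho n) ?N"
      using e unfolding fe SELT_rho good_def by blast
    moreover have "Rect (rho n) T = superstandard (rho2 n m)"
      using e superstandard_rho2[OF assms(1)] unfolding fe Rect_rho good_def by simp
    ultimately show "T \<in> ?A" by simp
  qed
  then have "d_coeff (rho n) (rho2 n m) (rho n) = card (good n m 1 0)"
    by (simp add: d_coeff_def card_image inj_on_def)
  then show ?thesis using card_good[of 1 m n 0] assms sum_choose_two[OF assms(1)] by simp
qed

end
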